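(* Let $R_2$ be the ring generated over $\mathbb{Z}$ by the recursively defined transformations $s=\begin{pmatrix}0&0\\1&0\end{pmatrix}$ and $t=\begin{pmatrix}0&t\\0&s\end{pmatrix}$ (as made precise in the context). (i) Let $\mu(R_2)$ be the multiplicative semigroup generated by $s,t$. Then $\mu(R_2)$ is nil of degree $5$ (that is, $w^5=0$ for all $w\in\mu(R_2)$, and there is $w\in\mu(R_2)$ with $w^4\neq 0$). (ii) Let $F=\langle\sigma,\tau\rangle$ be the free (non-unital) associative ring on $\sigma,\tau$ and let $\lambda$ be the endomorphism of $F$ defined by $\lambda:\sigma\mapsto\tau,\ \tau\mapsto\sigma\tau$. Then $R_2$ affords the monomial presentation $\langle\sigma,\tau\mid u_i=0\ (i\ge 1)\rangle$ (with $\sigma\mapsto s$, $\tau\mapsto t$), where $$u_1=\sigma^2,\qquad u_{2i}=\tau\cdot(u_{2i-1})^{\lambda},\qquad u_{2i+1}=(u_{2i})^{\lambda}\quad(i\ge1).$$ (iii) The Gelfand–Kirillov dimension of $R_2$ is $1+\frac{\log 2}{\log\alpha}$, where $\alpha=\frac{1+\sqrt5}{2}$.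
   Context: Let $S$ be the set of all finite words (including the empty word $\phi$) on the alphabet $\{y_1,y_2\}$, and let $V$ be the $\mathbb{Q}$-vector space with basis $S$. Linear operators act on the right (so $ab$ means first $a$, then $b$). A linear operator $L$ on $V$ preserving the span of words of each fixed length is given by a scalar $L_\phi$ with $(\phi)L=L_\phi\phi$ and operators $L_{ij}$ of the same kind with $(y_iu)L=\sum_j y_j\cdot(u)L_{ij}$ for all $u\in S$; one writes $L=\begin{pmatrix}L_{11}&L_{12}\\L_{21}&L_{22}\end{pmatrix}$. The operators $s,t$ are the unique ones with $s_\phi=t_\phi=0$ and the displayed block forms, i.e. for all $u\in S$: $(\phi)s=0$, $(y_1u)s=0$, $(y_2u)s=y_1u$; $(\phi)t=0$, $(y_1u)t=y_2\cdot(u)t$, $(y_2u)t=y_2\cdot(u)s$. $R_2$ is the (non-unital) subring of $\mathrm{End}_{\mathbb{Q}}(V)$ generated by $s,t$, i.e. the set of $\mathbb{Z}$-linear combinations of nonempty products of $s,t$. The presentation statement means that the kernel of the surjective ring homomorphism $F\to R_2$, $\sigma\mapsto s,\tau\mapsto t$, is the two-sided ideal generated by the $u_i$. The Gelfand–Kirillov dimension is $\limsup_{n\to\infty}\frac{\log F(n)}{\log n}$, where $F(n)$ is the $\mathbb{Z}$-rank of the span of all products of at most $n$ factors from $\{s,t\}$. *)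

theory Defs
  imports Complex_Main "HOL-Library.Poly_Mapping" "HOL-Library.Extended_Real"
begin

section \<open>Words and noncommutative polynomials\<close>

text \<open>
  Words form a monoid, written additively because \<^typ>\<open>'a \<Rightarrow>\<^sub>0 'b\<close> expects its exponents
  to do so.  Consequently \<^typ>\<open>'a list \<Rightarrow>\<^sub>0 'b\<close> carries the multiplication of the free
  associative unital algebra over \<^typ>\<open>'b\<close> on the set of all letters of type \<^typ>\<open>'a\<close>.
\<close>

instantiation list :: (type) monoid_add
begin

definition zero_list :: "'a list" where "zero_list = []"

definition plus_list :: "'a list \<Rightarrow> 'a list \<Rightarrow> 'a list" where "plus_list u v = u @ v"

instance by standard (simp_all add: zero_list_def plus_list_def)

end

abbreviation word :: "'a list \<Rightarrow> ('a list \<Rightarrow>\<^sub>0 'b::zero_neq_one)" where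
  "word u \<equiv> Poly_Mapping.single u 1"

lemma word_mult: "word u * word v = (word (u @ v) :: 'a list \<Rightarrow>\<^sub>0 'b::semiring_1)"
  by (simp add: mult_single plus_list_def)

lemma word_Nil: "word [] = (1 :: 'a list \<Rightarrow>\<^sub>0 'b::semiring_1)"
  by (metis single_one zero_list_def)

section \<open>The space of words and its operators\<close>

datatype letter = Y1 | Y2

type_synonym vec = "letter list \<Rightarrow>\<^sub>0 rat"

definition scale :: "rat \<Rightarrow> vec \<Rightarrow> vec" where
  "scale c v = Poly_Mapping.map ((*) c) v"

lemma lookup_scale [simp]:
  "Poly_Mapping.lookup (scale c v) u = c * Poly_Mapping.lookup v u"
  by (simp add: scale_def Poly_Mapping.map.rep_eq when_def)

interpretation vec: vector_space scale
  by standard (auto intro!: poly_mapping_eqI simp: lookup_add algebra_simps)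

definition lin_ext :: "(letter list \<Rightarrow> vec) \<Rightarrow> vec \<Rightarrow> vec" where
  "lin_ext f v = (\<Sum>u\<in>Poly_Mapping.keys v. scale (Poly_Mapping.lookup v u) (f u))"

lemma lin_ext_superset:
  assumes "finite A" "Poly_Mapping.keys v \<subseteq> A"
  shows "lin_ext f v = (\<Sum>u\<in>A. scale (Poly_Mapping.lookup v u) (f u))"
  unfolding lin_ext_def
  by (rule sum.mono_neutral_left) (use assms in \<open>auto simp: in_keys_iff\<close>)

lemma linear_lin_ext: "Vector_Spaces.linear scale scale (lin_ext f)"
proof
  fix v w :: vec
  let ?A = "Poly_Mapping.keys v \<union> Poly_Mapping.keys w"
  have "Poly_Mapping.keys (v + w) \<subseteq> ?A"
    by (rule Poly_Mapping.keys_add)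
  then show "lin_ext f (v + w) = lin_ext f v + lin_ext f w"
    by (simp add: lin_ext_superset[where A = ?A] lookup_add vec.scale_left_distrib sum.distrib)
next
  fix c and v :: vec
  have "Poly_Mapping.keys (scale c v) \<subseteq> Poly_Mapping.keys v"
    by (auto simp: in_keys_iff)
  then show "lin_ext f (scale c v) = scale c (lin_ext f v)"
    by (simp add: lin_ext_superset[where A = "Poly_Mapping.keys v"] vec.scale_sum_right)
qed

lemma lin_ext_word [simp]: "lin_ext f (word u) = f u"
  by (simp add: lin_ext_def)

lemma lin_ext_unique:
  assumes "Vector_Spaces.linear scale scale g"
  shows "g v = lin_ext (\<lambda>u. g (word u)) v"
proof -
  interpret g: Vector_Spaces.linear scale scale g by fact
  have "v = (\<Sum>u\<in>Poly_Mapping.keys v. scale (Poly_Mapping.lookup v u) (word u))"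
    by (rule poly_mapping_eqI)
      (auto simp: lookup_sum lookup_single when_def in_keys_iff if_distrib
            cong: if_cong)
  then have "g v = g (\<Sum>u\<in>Poly_Mapping.keys v. scale (Poly_Mapping.lookup v u) (word u))"
    by simp
  then show ?thesis
    by (simp add: lin_ext_def g.sum g.scale)
qed

lemma linear_scale_iff:
  "Vector_Spaces.linear scale scale f \<longleftrightarrow>
     (\<forall>v w. f (v + w) = f v + f w) \<and> (\<forall>c v. f (scale c v) = scale c (f v))"
  by (simp add: Vector_Spaces.linear_def module_hom_iff vec.vector_space_axioms vec.module_axioms)

typedef operator = "{f :: vec \<Rightarrow> vec. Vector_Spaces.linear scale scale f}"
  morphisms app Operator
  using linear_lin_ext by blast

setup_lifting type_definition_operator

text \<open>
  Operators act on the right: \<open>L * M\<close> applies \<open>L\<close> first and then \<open>M\<close>, so that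
  \<open>app L v\<close> stands for $(v)L$.
\<close>

instantiation operator :: ring_1
begin

lift_definition zero_operator :: operator is "\<lambda>v. 0"
  by (simp add: linear_scale_iff)

lift_definition one_operator :: operator is "\<lambda>v. v"
  by (simp add: linear_scale_iff)

lift_definition plus_operator :: "operator \<Rightarrow> operator \<Rightarrow> operator" is "\<lambda>f g v. f v + g v"
  by (simp add: linear_scale_iff vec.scale_right_distrib vec.scale_right_diff_distrib)

lift_definition minus_operator :: "operator \<Rightarrow> operator \<Rightarrow> operator" is "\<lambda>f g v. f v - g v"
  by (simp add: linear_scale_iff vec.scale_right_distrib vec.scale_right_diff_distrib)

lift_definition uminus_operator :: "operator \<Rightarrow> operator" is "\<lambda>f v. - f v"
  by (simp add: linear_scale_iff vec.scale_right_distrib vec.scale_right_diff_distrib)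

lift_definition times_operator :: "operator \<Rightarrow> operator \<Rightarrow> operator" is "\<lambda>f g v. g (f v)"
  by (simp add: linear_scale_iff)

instance
proof
  show "(0::operator) \<noteq> 1"
  proof
    assume "(0::operator) = 1"
    then have "Poly_Mapping.lookup (app 0 (word [])) [] = Poly_Mapping.lookup (app 1 (word [])) []"
      by simp
    then show False by (simp add: zero_operator.rep_eq one_operator.rep_eq)
  qed
qed (transfer; simp add: linear_scale_iff algebra_simps)+

end

section \<open>The transformations \<open>s\<close> and \<open>t\<close>\<close>

fun s_word :: "letter list \<Rightarrow> vec" where
  "s_word [] = 0"
| "s_word (Y1 # u) = 0"
| "s_word (Y2 # u) = word (Y1 # u)"

text \<open>Multiplying by \<open>word [y]\<close> on the left prepends the letter \<open>y\<close> to every word of a vector.\<close>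

fun t_word :: "letter list \<Rightarrow> vec" where
  "t_word [] = 0"
| "t_word (Y1 # u) = word [Y2] * t_word u"
| "t_word (Y2 # u) = word [Y2] * s_word u"

lift_definition s_op :: operator is "lin_ext s_word" by (rule linear_lin_ext)

lift_definition t_op :: operator is "lin_ext t_word" by (rule linear_lin_ext)

text \<open>
  The two operators are the unique ones with the block forms
  $s = \begin{pmatrix}0&0\cr 1&0\end{pmatrix}$, $t = \begin{pmatrix}0&t\cr 0&s\end{pmatrix}$
  and vanishing on the empty word.
\<close>

definition has_block_form ::
  "operator \<Rightarrow> rat \<Rightarrow> operator \<Rightarrow> operator \<Rightarrow> operator \<Rightarrow> operator \<Rightarrow> bool" where
  "has_block_form L c L11 L12 L21 L22 \<longleftrightarrow>
     app L (word []) = scale c (word []) \<and>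
     (\<forall>u. app L (word (Y1 # u)) = word [Y1] * app L11 (word u) + word [Y2] * app L12 (word u)) \<and>
     (\<forall>u. app L (word (Y2 # u)) = word [Y1] * app L21 (word u) + word [Y2] * app L22 (word u))"

lemma operator_eqI:
  assumes "\<And>u. app L (word u) = app M (word u)"
  shows "L = M"
proof -
  have "app L v = app M v" for v
    using lin_ext_unique[of "app L" v] lin_ext_unique[of "app M" v] app[of L] app[of M] assms
    by simp
  then show ?thesis by (simp add: app_inject[symmetric] fun_eq_iff)
qed

lemma s_op_block_form: "has_block_form L 0 0 0 1 0 \<longleftrightarrow> L = s_op"
proof
  assume L: "has_block_form L 0 0 0 1 0"
  show "L = s_op"
  proof (rule operator_eqI)
    fix u show "app L (word u) = app s_op (word u)"
      using L by (cases u rule: s_word.cases)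
        (auto simp: has_block_form_def s_op.rep_eq zero_operator.rep_eq one_operator.rep_eq word_mult)
  qed
qed (auto simp: has_block_form_def s_op.rep_eq zero_operator.rep_eq one_operator.rep_eq word_mult)

lemma t_op_block_form: "has_block_form L 0 0 L 0 s_op \<longleftrightarrow> L = t_op"
proof
  assume L: "has_block_form L 0 0 L 0 s_op"
  show "L = t_op"
  proof (rule operator_eqI)
    fix u show "app L (word u) = app t_op (word u)"
      using L by (induction u rule: t_word.induct)
        (auto simp: has_block_form_def t_op.rep_eq s_op.rep_eq zero_operator.rep_eq)
  qed
qed (auto simp: has_block_form_def t_op.rep_eq s_op.rep_eq zero_operator.rep_eq)

section \<open>Generated semigroups, rings and ideals\<close>

text \<open>Rings are not assumed to contain the unit of the ambient type.\<close>

definition is_mult_semigroup :: "'a::times set \<Rightarrow> bool" where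
  "is_mult_semigroup S \<longleftrightarrow> (\<forall>x\<in>S. \<forall>y\<in>S. x * y \<in> S)"

definition is_subrng :: "'a::ring set \<Rightarrow> bool" where
  "is_subrng S \<longleftrightarrow> 0 \<in> S \<and> (\<forall>x\<in>S. \<forall>y\<in>S. x - y \<in> S \<and> x * y \<in> S)"

definition is_ideal_of :: "'a::ring set \<Rightarrow> 'a set \<Rightarrow> bool" where
  "is_ideal_of R I \<longleftrightarrow> I \<subseteq> R \<and> 0 \<in> I \<and> (\<forall>x\<in>I. \<forall>y\<in>I. x - y \<in> I) \<and>
     (\<forall>a\<in>R. \<forall>x\<in>I. a * x \<in> I \<and> x * a \<in> I)"

definition R2 :: "operator set" where
  "R2 = is_subrng hull {s_op, t_op}"

definition mu_R2 :: "operator set" where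
  "mu_R2 = is_mult_semigroup hull {s_op, t_op}"

interpretation int_module: module "\<lambda>(k::int) (x::'a::ring_1). of_int k * x"
  by standard (simp_all add: algebra_simps)

lemma R2_eq_span: "R2 = int_module.span mu_R2"
proof
  have R2: "is_subrng R2"
    unfolding R2_def by (rule hull_in) (auto simp: is_subrng_def)
  have gen: "{s_op, t_op} \<subseteq> R2"
    unfolding R2_def by (rule hull_subset)
  have mu: "is_mult_semigroup mu_R2"
    unfolding mu_R2_def by (rule hull_in) (auto simp: is_mult_semigroup_def)
  have add: "x + y \<in> R2" if "x \<in> R2" "y \<in> R2" for x y
  proof -
    have "x - (0 - y) \<in> R2"
      using R2 that unfolding is_subrng_def by blast
    then show ?thesis by simp
  qed
  have scale: "of_int k * x \<in> R2" if "x \<in> R2" for k x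
  proof (induction k rule: int_induct[where k = 0])
    case base
    show ?case using R2 by (simp add: is_subrng_def)
  next
    case (step1 i)
    then show ?case using add[of "of_int i * x" x] that by (simp add: distrib_right)
  next
    case (step2 i)
    then have "of_int i * x - x \<in> R2"
      using R2 that by (simp add: is_subrng_def)
    then show ?case by (simp add: left_diff_distrib)
  qed
  have "mu_R2 \<subseteq> R2"
    unfolding mu_R2_def
    by (rule hull_minimal[OF gen]) (use R2 in \<open>auto simp: is_subrng_def is_mult_semigroup_def\<close>)
  moreover have "int_module.subspace R2"
    unfolding int_module.subspace_def using R2 add scale is_subrng_def by blast
  ultimately show "int_module.span mu_R2 \<subseteq> R2"
    by (rule int_module.span_minimal)
  have left: "x * y \<in> int_module.span mu_R2"
    if "x \<in> mu_R2" "y \<in> int_module.span mu_R2" for x y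
    using that(2)
  proof (induction rule: int_module.span_induct_alt)
    case base
    show ?case by (simp add: int_module.span_zero)
  next
    case (step c z y)
    have "x * z \<in> mu_R2"
      using mu that(1) step(1) by (auto simp: is_mult_semigroup_def)
    then have "of_int c * (x * z) \<in> int_module.span mu_R2"
      by (intro int_module.span_scale int_module.span_base)
    then have "of_int c * (x * z) + x * y \<in> int_module.span mu_R2"
      using step(2) by (rule int_module.span_add)
    moreover have "x * (of_int c * z + y) = of_int c * (x * z) + x * y"
      using mult_of_int_commute[of c x] by (simp add: distrib_left flip: mult.assoc)
    ultimately show ?case by simp
  qed
  have "x * y \<in> int_module.span mu_R2"
    if "x \<in> int_module.span mu_R2" "y \<in> int_module.span mu_R2" for x y
    using that(1)
  proof (induction rule: int_module.span_induct_alt)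
    case base
    show ?case by (simp add: int_module.span_zero)
  next
    case (step c z x)
    have "of_int c * (z * y) + x * y \<in> int_module.span mu_R2"
      using step left[OF _ that(2)] by (intro int_module.span_add int_module.span_scale)
    then show ?case by (simp add: distrib_right mult.assoc)
  qed
  then have "is_subrng (int_module.span mu_R2)"
    by (auto simp: is_subrng_def int_module.span_zero int_module.span_diff)
  moreover have "{s_op, t_op} \<subseteq> int_module.span mu_R2"
    using hull_subset[of "{s_op, t_op}" is_mult_semigroup] int_module.span_superset[of mu_R2]
    unfolding mu_R2_def by blast
  ultimately show "R2 \<subseteq> int_module.span mu_R2"
    unfolding R2_def by (intro hull_minimal)
qed

section \<open>Presentations of non-unital rings\<close>

type_synonym 'g free_ring = "'g list \<Rightarrow>\<^sub>0 int"

definition free_rng :: "'g free_ring set" where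
  "free_rng = {p. Poly_Mapping.lookup p [] = 0}"

definition evaluate :: "('g \<Rightarrow> 'r::ring_1) \<Rightarrow> 'g free_ring \<Rightarrow> 'r" where
  "evaluate f p = (\<Sum>w\<in>Poly_Mapping.keys p. of_int (Poly_Mapping.lookup p w) * prod_list (map f w))"

lemma evaluate_superset:
  assumes "finite A" "Poly_Mapping.keys p \<subseteq> A"
  shows "evaluate f p = (\<Sum>w\<in>A. of_int (Poly_Mapping.lookup p w) * prod_list (map f w))"
  unfolding evaluate_def
  by (rule sum.mono_neutral_left) (use assms in \<open>auto simp: in_keys_iff\<close>)

lemma evaluate_single: "evaluate f (Poly_Mapping.single w c) = of_int c * prod_list (map f w)"
  by (simp add: evaluate_def)

lemma evaluate_generator: "evaluate f (word [g]) = f g"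
  by (simp add: evaluate_single)

lemma evaluate_zero [simp]: "evaluate f 0 = 0"
  by (simp add: evaluate_def)

lemma evaluate_add: "evaluate f (p + q) = evaluate f p + evaluate f q"
proof -
  let ?A = "Poly_Mapping.keys p \<union> Poly_Mapping.keys q"
  have "Poly_Mapping.keys (p + q) \<subseteq> ?A"
    by (rule Poly_Mapping.keys_add)
  then show ?thesis
    by (simp add: evaluate_superset[where A = ?A] lookup_add distrib_right sum.distrib)
qed

lemma evaluate_sum: "evaluate f (sum p A) = (\<Sum>x\<in>A. evaluate f (p x))"
  by (induction A rule: infinite_finite_induct) (simp_all add: evaluate_add)

lemma free_ring_expansion:
  "p = (\<Sum>w\<in>Poly_Mapping.keys p. Poly_Mapping.single w (Poly_Mapping.lookup p w))"
  by (rule poly_mapping_eqI) (auto simp: lookup_sum lookup_single when_def in_keys_iff)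

lemma evaluate_mult:
  fixes f :: "'g \<Rightarrow> 'r::ring_1"
  shows "evaluate f (p * q) = evaluate f p * evaluate f q"
proof -
  have single: "evaluate f (Poly_Mapping.single u a * Poly_Mapping.single v b) =
      evaluate f (Poly_Mapping.single u a) * evaluate f (Poly_Mapping.single v b)" for u v a b
  proof -
    have "of_int b * prod_list (map f u) = prod_list (map f u) * of_int b"
      by (rule mult_of_int_commute)
    then have "of_int a * of_int b * (prod_list (map f u) * prod_list (map f v)) =
        of_int a * prod_list (map f u) * (of_int b * prod_list (map f v))"
      by (metis mult.assoc)
    then show ?thesis
      by (simp only: mult_single evaluate_single plus_list_def of_int_mult map_append prod_list.append)
  qed
  have "evaluate f (p * q) = evaluate f
     ((\<Sum>u\<in>Poly_Mapping.keys p. Poly_Mapping.single u (Poly_Mapping.lookup p u)) *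
      (\<Sum>v\<in>Poly_Mapping.keys q. Poly_Mapping.single v (Poly_Mapping.lookup q v)))"
    using free_ring_expansion[of p] free_ring_expansion[of q] by simp
  also have "\<dots> = evaluate f
      (\<Sum>u\<in>Poly_Mapping.keys p. Poly_Mapping.single u (Poly_Mapping.lookup p u)) *
     evaluate f (\<Sum>v\<in>Poly_Mapping.keys q. Poly_Mapping.single v (Poly_Mapping.lookup q v))"
    by (simp add: sum_product evaluate_sum single)
  also have "\<dots> = evaluate f p * evaluate f q"
    using free_ring_expansion[of p] free_ring_expansion[of q] by simp
  finally show ?thesis .
qed

definition affords_presentation ::
  "'r::ring_1 set \<Rightarrow> ('g \<Rightarrow> 'r) \<Rightarrow> 'g free_ring set \<Rightarrow> bool" where
  "affords_presentation R f U \<longleftrightarrow>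
     evaluate f ` free_rng = R \<and>
     {p \<in> free_rng. evaluate f p = 0} = is_ideal_of free_rng hull U"

section \<open>The relators\<close>

datatype gen = Sigma | Tau

abbreviation sigma :: "gen free_ring" where "sigma \<equiv> word [Sigma]"

abbreviation tau :: "gen free_ring" where "tau \<equiv> word [Tau]"

definition lam :: "gen free_ring \<Rightarrow> gen free_ring" where
  "lam = evaluate (case_gen tau (sigma * tau))"

text \<open>The value at \<open>0\<close> is a dummy: the sequence of relators starts at index \<open>1\<close>.\<close>

fun relator :: "nat \<Rightarrow> gen free_ring" where
  "relator 0 = 0"
| "relator (Suc 0) = sigma ^ 2"
| "relator (Suc (Suc n)) = (if even n then tau * lam (relator (Suc n)) else lam (relator (Suc n)))"

lemma relator_even: "i \<ge> 1 \<Longrightarrow> relator (2 * i) = tau * lam (relator (2 * i - 1))"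
  by (cases i) simp_all

lemma relator_odd: "i \<ge> 1 \<Longrightarrow> relator (2 * i + 1) = lam (relator (2 * i))"
  by (cases i) simp_all

section \<open>Gelfand--Kirillov dimension\<close>

text \<open>
  The rank is the largest number of \<open>\<int>\<close>-linearly independent elements; it is meaningful
  only for subgroups in which these numbers are bounded, such as finitely generated ones.
\<close>

definition Z_rank :: "'a::ring_1 set \<Rightarrow> nat" where
  "Z_rank A = Sup {card B | B. B \<subseteq> A \<and> finite B \<and> int_module.independent B}"

definition products_upto :: "'a::monoid_mult set \<Rightarrow> nat \<Rightarrow> 'a set" where
  "products_upto X n = {prod_list xs | xs. xs \<noteq> [] \<and> set xs \<subseteq> X \<and> length xs \<le> n}"

text \<open>The dimension of the ring generated by the finite set \<open>X\<close>.\<close>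

definition GK_dim :: "'a::ring_1 set \<Rightarrow> ereal" where
  "GK_dim X = limsup (\<lambda>n. ereal (ln (real (Z_rank (int_module.span (products_upto X n)))) / ln (real n)))"

end

theory Submission
  imports Defs "HOL-Library.Sublist"
begin

text \<open>
  On basis words $s$ and $t$ act as partial injections, and a product of generators acts through
  its word $w$. In block form $\lambda(w)$ has lower right entry $w$, and its upper right entry is
  $t w'$ if $w = s w'$ and zero otherwise. Every nonzero word has no factor $s^2$, hence is
  $\lambda(w_0)$ or $\lambda(w_0)s$, and the blocks show that it is nonzero iff $w_0$ is, or
  $w_0 = s w'$ with $t w'$ nonzero. Everything follows from this desubstitution.

  \<^item> A pair of basis words is connected by at most one word, so the nonzero words are linearly
    independent and the relations are monomial. The minimal zero words are the relators.
  \<^item> A power of $w$ desubstitutes to a power of $t$, at the price of at most $t$ on the left and $s$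
    on the right in every step. As $t^3 = 0$, the lost letters sum up to less than what a fifth
    power would need.
  \<^item> The nonzero words are the suffixes of the products
    $\lambda^k(s)^{e_k} \cdots \lambda(s)^{e_1} s^{e_0}$ with $e_i \in \{0, 1\}$. Those of a given length comparable
    to $\alpha^k$ are determined by about $k$ free bits, so there are about $n \cdot 2^{\log_\alpha n}$
    nonzero words of length at most $n$.
\<close>

section \<open>The action on words\<close>

text \<open>\<open>None\<close> stands for the zero vector: a generator sends each basis word to a
  basis word or to 0, so partial maps on words record the operators completely.\<close>

fun s_step :: "letter list \<Rightarrow> letter list option" where
  "s_step [] = None"
| "s_step (Y1 # u) = None"
| "s_step (Y2 # u) = Some (Y1 # u)"

fun t_step :: "letter list \<Rightarrow> letter list option" where
  "t_step [] = None"
| "t_step (Y1 # u) = map_option ((#) Y2) (t_step u)"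
| "t_step (Y2 # u) = map_option ((#) Y2) (s_step u)"

fun act :: "gen list \<Rightarrow> letter list \<Rightarrow> letter list option" where
  "act [] u = Some u"
| "act (Sigma # w) u = Option.bind (s_step u) (act w)"
| "act (Tau # w) u = Option.bind (t_step u) (act w)"

definition lamw :: "gen list \<Rightarrow> gen list" where
  "lamw w = concat (map (case_gen [Tau] [Sigma, Tau]) w)"

text \<open>By \<open>opw_eq_0_iff\<close> this says that the operator spelled by \<open>w\<close>
  does not vanish.\<close>

definition nonzero :: "gen list \<Rightarrow> bool" where
  "nonzero w \<longleftrightarrow> (\<exists>u v. act w u = Some v)"

lemma lamw_simps [simp]:
  "lamw [] = []" "lamw (Sigma # w) = Tau # lamw w" "lamw (Tau # w) = Sigma # Tau # lamw w"
  "lamw (u @ w) = lamw u @ lamw w"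
  by (simp_all add: lamw_def)

lemma lamw_eq_Nil_iff [simp]: "lamw w = [] \<longleftrightarrow> w = []"
  by (cases w rule: list.exhaust; cases "hd w") auto

lemma gen_list_cases [case_names Nil Sigma Tau]:
  obtains "w = []" | w' where "w = Sigma # w'" | w' where "w = Tau # w'"
  by (cases w; cases "hd w") auto

lemma act_append: "act (x @ y) u = Option.bind (act x u) (act y)"
proof (induction x arbitrary: u)
  case (Cons g x)
  then show ?case by (cases g; cases "s_step u"; cases "t_step u") simp_all
qed simp

lemma act_Nil [simp]: "act w [] = (if w = [] then Some [] else None)"
  by (cases w rule: gen_list_cases) auto

text \<open>The image t of s acts as s behind a leading \<open>Y2\<close>. The image st of t first
  turns the \<open>Y2\<close> into \<open>Y1\<close>, then acts as t behind it and restores the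
  \<open>Y2\<close>.\<close>

lemma act_lamw_Y2 [simp]: "act (lamw w) (Y2 # u) = map_option ((#) Y2) (act w u)"
proof (induction w arbitrary: u)
  case (Cons g w)
  then show ?case
    by (cases g; cases u rule: s_step.cases; cases "t_step u") auto
qed simp

text \<open>The first \<open>Tau\<close> turns the leading \<open>Y1\<close> into \<open>Y2\<close>
  and acts as t, not s, on the rest; \<open>act_lamw_Y2\<close> covers the remaining
  letters.\<close>

lemma act_lamw_Sigma_Y1 [simp]:
  "act (lamw (Sigma # w)) (Y1 # u) = map_option ((#) Y2) (act (Tau # w) u)"
  by (cases "t_step u") auto

lemma act_lamw_Tau_Y1 [simp]: "act (lamw (Tau # w)) (Y1 # u) = None"
  by simp

lemma nonzero_sublist: "nonzero w \<Longrightarrow> sublist x w \<Longrightarrow> nonzero x"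
  by (fastforce simp: nonzero_def sublist_def act_append bind_eq_Some_conv)

lemma nonzero_ConsD: "nonzero (g # w) \<Longrightarrow> nonzero w"
  by (erule nonzero_sublist) (simp add: sublist_Cons_right)

lemma nonzero_Nil [simp]: "nonzero []"
  by (simp add: nonzero_def)

lemma nonzero_single [simp]: "nonzero [g]"
proof (cases g)
  case Sigma
  have "act [Sigma] [Y2] = Some [Y1]" by simp
  then show ?thesis unfolding nonzero_def Sigma by blast
next
  case Tau
  have "act [Tau] [Y2, Y2] = Some [Y2, Y1]" by simp
  then show ?thesis unfolding nonzero_def Tau by blast
qed

lemma not_nonzero_Sigma_Sigma: "\<not> nonzero [Sigma, Sigma]"
proof -
  have "act [Sigma, Sigma] u = None" for u
    by (cases u rule: s_step.cases) auto
  then show ?thesis by (simp add: nonzero_def)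
qed

text \<open>The two alternatives come from basis words with leading \<open>Y2\<close> and with
  leading \<open>Y1\<close>.\<close>

lemma nonzero_lamw:
  "nonzero (lamw w) \<longleftrightarrow> nonzero w \<or> (\<exists>w'. w = Sigma # w' \<and> nonzero (Tau # w'))"
proof
  assume "nonzero (lamw w)"
  then obtain u v where uv: "act (lamw w) u = Some v"
    by (auto simp: nonzero_def)
  show "nonzero w \<or> (\<exists>w'. w = Sigma # w' \<and> nonzero (Tau # w'))"
  proof (cases u rule: s_step.cases)
    case 1
    with uv show ?thesis by (auto split: if_splits)
  next
    case (2 u')
    show ?thesis
    proof (cases w rule: gen_list_cases)
      case (Sigma w')
      then show ?thesis using uv 2
        by (metis act_lamw_Sigma_Y1 nonzero_def option.map_disc_iff not_Some_eq)
    next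
      case (Tau w')
      then show ?thesis using uv 2 by simp
    qed simp
  next
    case (3 u')
    with uv show ?thesis by (auto simp: nonzero_def)
  qed
next
  assume "nonzero w \<or> (\<exists>w'. w = Sigma # w' \<and> nonzero (Tau # w'))"
  then show "nonzero (lamw w)"
  proof
    assume "nonzero w"
    then obtain u v where "act w u = Some v" by (auto simp: nonzero_def)
    then have "act (lamw w) (Y2 # u) = Some (Y2 # v)" by simp
    then show ?thesis unfolding nonzero_def by blast
  next
    assume "\<exists>w'. w = Sigma # w' \<and> nonzero (Tau # w')"
    then obtain w' u v where "w = Sigma # w'" "act (Tau # w') u = Some v"
      by (auto simp: nonzero_def)
    then have "act (lamw w) (Y1 # u) = Some (Y2 # v)"
      by (simp only: act_lamw_Sigma_Y1) simp
    then show ?thesis unfolding nonzero_def by blast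
  qed
qed

text \<open>A nonempty image ends in \<open>Tau\<close>, and t only yields words that begin with
  \<open>Y2\<close>. On these s is defined, which gives \<open>nonzero_lamw_Sigma\<close>.\<close>

lemma act_lamw_image:
  assumes "act (lamw w) u = Some v" "w \<noteq> []"
  obtains v' where "v = Y2 # v'"
proof (cases u rule: s_step.cases)
  case (2 u')
  show ?thesis
  proof (cases w rule: gen_list_cases)
    case (Sigma w')
    then have "map_option ((#) Y2) (act (Tau # w') u') = Some v"
      using assms(1) 2 act_lamw_Sigma_Y1 by metis
    then show ?thesis using that by auto
  qed (use assms 2 in simp_all)
qed (use assms in \<open>auto intro: that\<close>)

lemma nonzero_lamw_Sigma: "nonzero (lamw w @ [Sigma]) \<longleftrightarrow> nonzero (lamw w)"
proof
  assume "nonzero (lamw w)"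
  then obtain u v where uv: "act (lamw w) u = Some v"
    by (auto simp: nonzero_def)
  show "nonzero (lamw w @ [Sigma])"
  proof (cases "w = []")
    case False
    then obtain v' where "v = Y2 # v'" using act_lamw_image uv by metis
    then have "act (lamw w @ [Sigma]) u = Some (Y1 # v')" using uv by (simp add: act_append)
    then show ?thesis unfolding nonzero_def by blast
  qed simp
qed (auto intro: nonzero_sublist)

section \<open>Desubstitution\<close>

text \<open>The word is read from the left in blocks \<open>[Tau]\<close> and
  \<open>[Sigma, Tau]\<close>; a \<open>Sigma\<close> that no \<open>Tau\<close> follows can only be
  the last letter.\<close>

lemma lamw_decomposition:
  assumes "\<not> sublist [Sigma, Sigma] w"
  obtains w0 where "w = lamw w0" | w0 where "w = lamw w0 @ [Sigma]"
proof -
  have "(\<exists>w0. w = lamw w0) \<or> (\<exists>w0. w = lamw w0 @ [Sigma])"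
    using assms
  proof (induction w rule: length_induct)
    case (1 w)
    show ?case
    proof (cases w rule: gen_list_cases)
      case Nil
      then show ?thesis by (metis lamw_simps(1))
    next
      case (Tau w1)
      with 1 have "(\<exists>w0. w1 = lamw w0) \<or> (\<exists>w0. w1 = lamw w0 @ [Sigma])"
        by (simp add: sublist_Cons_right)
      then show ?thesis
        unfolding Tau by (metis lamw_simps(2) append_Cons)
    next
      case (Sigma w1)
      show ?thesis
      proof (cases w1 rule: gen_list_cases)
        case Nil
        with Sigma show ?thesis by (metis lamw_simps(1) append_Nil)
      next
        case (Sigma w2)
        with \<open>w = Sigma # w1\<close> 1 show ?thesis by (auto simp: sublist_Cons_right)
      next
        case (Tau w2)
        with \<open>w = Sigma # w1\<close> 1 have "(\<exists>w0. w2 = lamw w0) \<or> (\<exists>w0. w2 = lamw w0 @ [Sigma])"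
          by (simp add: sublist_Cons_right)
        then show ?thesis
          unfolding Tau \<open>w = Sigma # w1\<close> by (metis lamw_simps(3) append_Cons)
      qed
    qed
  qed
  then show ?thesis using that by blast
qed

lemma nonzero_no_Sigma_Sigma: "nonzero w \<Longrightarrow> \<not> sublist [Sigma, Sigma] w"
  using nonzero_sublist not_nonzero_Sigma_Sigma by blast

lemma nonzero_decomposition:
  assumes "nonzero w"
  obtains w0 where "w = lamw w0" "nonzero (lamw w0)"
  | w0 where "w = lamw w0 @ [Sigma]" "nonzero (lamw w0)"
  using lamw_decomposition[OF nonzero_no_Sigma_Sigma[OF assms]] assms nonzero_lamw_Sigma
  by metis

lemma last_lamw: "w \<noteq> [] \<Longrightarrow> last (lamw w) = Tau"
proof (induction w rule: rev_induct)
  case (snoc g w)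
  then show ?case by (cases g) auto
qed simp

lemma lamw_snoc_Tau: "w \<noteq> [] \<Longrightarrow> \<exists>x. lamw w = x @ [Tau]"
  by (metis last_lamw append_butlast_last_id lamw_eq_Nil_iff)

text \<open>The two blocks differ in their first letter, so images are decoded uniquely from the
  left.\<close>

lemma prefix_lamw_iff: "prefix (lamw a) (lamw b) \<longleftrightarrow> prefix a b"
proof (induction a arbitrary: b)
  case (Cons g a)
  then show ?case by (cases b rule: gen_list_cases; cases g) auto
qed simp

lemma lamw_inj: "lamw a = lamw b \<longleftrightarrow> a = b"
  using prefix_lamw_iff by (metis prefix_order.antisym prefix_order.refl)

text \<open>This separation of words underlies linear independence and the monomial presentation.
  Both words are desubstituted, and their preimages are compared on the tail of the basis
  word.\<close>

lemma act_unique: "act x u = Some v \<Longrightarrow> act w u = Some v \<Longrightarrow> x = w"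
proof (induction u arbitrary: v x w)
  case Nil
  then show ?case by (auto split: if_splits)
next
  case (Cons a u)
  have nz: "nonzero x" "nonzero w" using Cons.prems by (auto simp: nonzero_def)
  \<comment> \<open>\<open>P y v\<close> expresses, through the action on the tail \<open>u\<close>,
    that \<open>lamw y\<close> sends \<open>a # u\<close> to \<open>Y2 # v\<close>.\<close>
  define P where "P y v \<longleftrightarrow> (case a of Y2 \<Rightarrow> act y u = Some v
    | Y1 \<Rightarrow> (\<exists>y'. y = Sigma # y' \<and> act (Tau # y') u = Some v))" for y v
  \<comment> \<open>The first letter of the result tells whether a final \<open>Sigma\<close>
    follows the image.\<close>
  have shape: "(y = [] \<and> v = a # u) \<or> (\<exists>y0 v'. y = lamw y0 \<and> v = Y2 # v' \<and> P y0 v')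
      \<or> (\<exists>y0 v'. y = lamw y0 @ [Sigma] \<and> v = Y1 # v' \<and> P y0 v')"
    if y: "act y (a # u) = Some v" for y
  proof -
    have lam: "(y0 = [] \<and> v = a # u) \<or> (\<exists>v'. v = Y2 # v' \<and> P y0 v')"
      if "act (lamw y0) (a # u) = Some v" for y0 v
      using that unfolding P_def
      by (cases a; cases y0 rule: gen_list_cases)
         (auto simp del: lamw_simps(2-3) act.simps(2-3))
    have "nonzero y" using y by (auto simp: nonzero_def)
    then show ?thesis
    proof (cases y rule: nonzero_decomposition)
      case (1 y0)
      then show ?thesis using lam[of y0 v] y by auto
    next
      case (2 y0)
      then obtain v1 where v1: "act (lamw y0) (a # u) = Some v1" "s_step v1 = Some v"
        using y by (auto simp: act_append bind_eq_Some_conv)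
      show ?thesis
        using lam[OF v1(1)]
      proof
        assume *: "y0 = [] \<and> v1 = a # u"
        then have "a = Y2" "v = Y1 # u" using v1(2) by (cases a; simp)+
        then show ?thesis using * 2 unfolding P_def by auto
      next
        assume "\<exists>v'. v1 = Y2 # v' \<and> P y0 v'"
        then show ?thesis using 2 v1(2) by auto
      qed
    qed
  qed
  have P_unique: "y = z" if P: "P y v" "P z v" for y z v
  proof (cases a)
    case Y1
    then obtain y' z' where "y = Sigma # y'" "z = Sigma # z'"
      "act (Tau # y') u = Some v" "act (Tau # z') u = Some v"
      using P unfolding P_def by auto
    then show ?thesis using Cons.IH by blast
  next
    case Y2
    then show ?thesis using P Cons.IH unfolding P_def by simp
  qed
  \<comment> \<open>The empty word fixes \<open>a # u\<close>; this rules out a second word with the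
    same effect.\<close>
  have P_id: "y = [] \<and> a = Y2" if P: "P y u" for y
  proof (cases a)
    case Y1
    then obtain y' where "act (Tau # y') u = Some u"
      using P unfolding P_def by auto
    then have "Tau # y' = []" using Cons.IH act.simps(1) by blast
    then show ?thesis by simp
  next
    case Y2
    then show ?thesis using P Cons.IH[of y u "[]"] unfolding P_def by simp
  qed
  show ?case
    using shape[OF Cons.prems(1)] shape[OF Cons.prems(2)]
    by (elim disjE exE conjE; metis P_id P_unique lamw_simps(1) list.inject letter.distinct(1))
qed

section \<open>Lengths under iterated substitution\<close>

text \<open>Desubstituting a word while raising \<open>j\<close> by one keeps this length
  (\<open>len_lam_lamw\<close>), so an induction can descend through preimages and still measure the
  original word.\<close>

definition len_lam :: "nat \<Rightarrow> gen list \<Rightarrow> nat" where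
  "len_lam j w = length ((lamw ^^ j) w)"

text \<open>The Fibonacci numbers 1, 1, 2, 3, 5, ...\<close>

definition fl :: "nat \<Rightarrow> nat" where
  "fl j = len_lam j [Sigma]"

lemma funpow_lamw_append: "(lamw ^^ j) (u @ w) = (lamw ^^ j) u @ (lamw ^^ j) w"
  by (induction j) simp_all

lemma funpow_lamw_Nil [simp]: "(lamw ^^ j) [] = []"
  by (induction j) simp_all

lemma len_lam_0 [simp]: "len_lam 0 w = length w"
  by (simp add: len_lam_def)

lemma len_lam_Nil [simp]: "len_lam j [] = 0"
  by (simp add: len_lam_def)

lemma len_lam_append [simp]: "len_lam j (u @ w) = len_lam j u + len_lam j w"
  by (simp add: len_lam_def funpow_lamw_append)

lemma len_lam_lamw [simp]: "len_lam j (lamw w) = len_lam (Suc j) w"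
  by (simp only: len_lam_def funpow_Suc_right comp_def)

lemma len_lam_Cons_Sigma [simp]: "len_lam j (Sigma # w) = fl j + len_lam j w"
  using len_lam_append[of j "[Sigma]" w] by (simp add: fl_def del: len_lam_append)

lemma len_lam_Cons_Tau [simp]: "len_lam j (Tau # w) = fl (Suc j) + len_lam j w"
  using len_lam_append[of j "[Tau]" w] len_lam_lamw[of j "[Sigma]"] by simp

lemma fl_0 [simp]: "fl 0 = 1" and fl_Suc_0 [simp]: "fl (Suc 0) = 1"
  unfolding fl_def len_lam_def by simp_all

lemma fl_Suc_Suc: "fl (Suc (Suc j)) = fl j + fl (Suc j)"
proof -
  have "fl (Suc (Suc j)) = len_lam (Suc j) [Tau]" by simp
  also have "\<dots> = len_lam j (lamw [Tau])" by (simp only: len_lam_lamw)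
  also have "\<dots> = fl j + fl (Suc j)" by simp
  finally show ?thesis .
qed

lemma fl_Suc_mono: "fl j \<le> fl (Suc j)"
  by (cases j) (simp_all add: fl_Suc_Suc)

lemma fl_mono: "i \<le> j \<Longrightarrow> fl i \<le> fl j"
  using fl_Suc_mono by (rule lift_Suc_mono_le)

lemma len_lam_suffix: "suffix u w \<Longrightarrow> len_lam j u \<le> len_lam j w"
  by (auto simp: suffix_def)

text \<open>A cut falls either between two blocks or inside a block \<open>[Sigma, Tau]\<close>,
  which leaves its \<open>Tau\<close>.\<close>

lemma suffix_lamwD:
  assumes "suffix z (lamw x)"
  obtains y where "suffix y x" "z = lamw y"
  | y where "suffix (Tau # y) x" "z = Tau # lamw y"
proof -
  have "\<exists>y. suffix y x \<and> z = lamw y \<or> suffix (Tau # y) x \<and> z = Tau # lamw y"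
    using assms
  proof (induction x)
    case (Cons g x)
    consider "suffix z (lamw x)" | "z = lamw (g # x)" | "g = Tau" "z = Tau # lamw x"
      using Cons.prems by (cases g) (auto simp: suffix_Cons)
    then show ?case
    proof cases
      case 1
      then show ?thesis using Cons.IH suffix_ConsI by metis
    qed auto
  qed auto
  then show ?thesis using that by blast
qed

section \<open>Nilpotency\<close>

text \<open>ttt is the image of sss, and both readings of sss in \<open>nonzero_lamw\<close> contain
  ss.\<close>

lemma not_nonzero_Tau_Tau_Tau: "\<not> nonzero [Tau, Tau, Tau]"
proof -
  have "\<not> nonzero (lamw [Sigma, Sigma, Sigma])"
    unfolding nonzero_lamw
    using nonzero_no_Sigma_Sigma[of "[Sigma, Sigma, Sigma]"]
      nonzero_no_Sigma_Sigma[of "[Tau, Sigma, Sigma]"]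
    by (auto simp: sublist_Cons_right)
  then show ?thesis by simp
qed

lemma suffix_append_same_length:
  "suffix z (u @ w) \<Longrightarrow> length z \<le> length w \<Longrightarrow> suffix z w"
  by (metis suffix_length_suffix suffixI)

text \<open>Here and below \<open>suffix z (z @ v)\<close> encodes that \<open>z\<close> is a suffix
  of a power of \<open>v\<close>; whole copies of \<open>v\<close> are stripped from the
  end.\<close>

lemma periodic_set:
  assumes "suffix z (z @ v)" "v \<noteq> []"
  shows "set z \<subseteq> set v"
  using assms(1)
proof (induction z rule: length_induct)
  case (1 z)
  show ?case
  proof (cases "length z \<le> length v")
    case True
    then show ?thesis
      using 1 suffix_append_same_length set_mono_suffix by blast
  next
    case False
    then have "suffix v z"
      using suffix_length_suffix[OF _ 1(2), of v] by (simp add: suffix_def)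
    then obtain x where x: "z = x @ v" by (auto simp: suffix_def)
    then have "suffix x (x @ v)" using 1(2) by (auto simp: suffix_def)
    then have "set x \<subseteq> set v" using 1(1) x assms(2) by simp
    then show ?thesis using x by simp
  qed
qed

lemma length_lamw_less: "Tau \<in> set w \<Longrightarrow> length w < length (lamw w)"
proof -
  have le: "length w \<le> length (lamw w)" for w
  proof (induction w)
    case (Cons g w)
    then show ?case by (cases g) simp_all
  qed simp
  assume "Tau \<in> set w"
  then obtain a b where "w = a @ Tau # b" by (meson split_list)
  then show ?thesis using le[of a] le[of b] by simp
qed

text \<open>A \<open>Tau\<close> at the very front may be the image of \<open>Sigma\<close> or the
  rest of a block \<open>[Sigma, Tau]\<close>. A leading \<open>Sigma\<close> of \<open>x\<close> is
  therefore dropped, at the price \<open>fl (Suc j)\<close>; what remains is periodic and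
  nonzero.\<close>

lemma periodic_desubstitution:
  assumes "nonzero (lamw x)" "suffix (lamw x) (lamw x @ v)" "length v \<le> length (lamw x)"
  obtains z v0 where "v = lamw v0" "nonzero z" "suffix z (z @ v0)"
    "\<And>j. len_lam j (lamw x) \<le> fl (Suc j) + len_lam (Suc j) z"
proof -
  have "suffix v (lamw x)"
    using suffix_length_suffix[OF _ assms(2), of v] assms(3) by (simp add: suffix_def)
  then obtain v0 where v0: "v = lamw v0"
    by (cases rule: suffix_lamwD) (auto, metis lamw_simps(2))
  have "suffix (lamw x) (lamw (x @ v0))"
    using assms(2) v0 by simp
  then have y: "suffix x (x @ v0) \<or> (\<exists>y. x = Sigma # y \<and> suffix y (x @ v0))"
  proof (cases rule: suffix_lamwD)
    case (1 y)
    then show ?thesis by (simp add: lamw_inj)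
  next
    case (2 y)
    then have "lamw x = lamw (Sigma # y)" by simp
    then have "x = Sigma # y" by (simp only: lamw_inj)
    then show ?thesis using suffix_ConsD[OF 2(1)] by blast
  qed
  show ?thesis
  proof (cases "\<exists>y. x = Sigma # y")
    case True
    then obtain y where x: "x = Sigma # y" by blast
    have "nonzero (Sigma # y) \<or> nonzero (Tau # y)"
      using assms(1) x unfolding nonzero_lamw by blast
    then have "nonzero y" using nonzero_ConsD by blast
    moreover have "suffix y (Sigma # (y @ v0))"
      using y x by (auto dest: suffix_ConsD)
    then have "suffix y (y @ v0)"
      using suffix_append_same_length[of y "[Sigma]" "y @ v0"] by simp
    ultimately show ?thesis
      using that[OF v0] x by simp
  next
    case False
    then have "nonzero x" "suffix x (x @ v0)"
      using assms(1) y nonzero_lamw by auto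
    then show ?thesis
      using that[OF v0] by simp
  qed
qed

text \<open>
  Desubstituting a periodic word costs at most the first letter \<open>Tau\<close>, whose left neighbour
  is not determined, and a last letter \<open>Sigma\<close>. The term \<^term>\<open>fl (j + 3)\<close> pays for the sum of all
  these losses until the period has become a power of \<open>Tau\<close>.
\<close>

lemma periodic_length_bound:
  assumes "nonzero z" "suffix z (z @ v)" "Tau \<in> set v"
  shows "len_lam j z + fl (j + 3) \<le> 5 * len_lam j v"
  using assms
proof (induction v arbitrary: z j rule: length_induct)
  case (1 v)
  have fl3: "fl (j + 3) = 2 * fl (Suc j) + fl j"
    by (simp add: numeral_3_eq_3 fl_Suc_Suc)
  \<comment> \<open>One level up, the correction grows by exactly the weights \<open>fl j\<close> of
    a lost \<open>Sigma\<close> and \<open>fl (Suc j)\<close> of a lost \<open>Tau\<close>.\<close>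
  have fl4: "fl (Suc j + 3) = fl (j + 3) + fl j + fl (Suc j)"
    by (simp add: numeral_3_eq_3 fl_Suc_Suc)
  obtain a b where ab: "v = a @ Tau # b" using \<open>Tau \<in> set v\<close> by (meson split_list)
  then have Tau_le: "fl (Suc j) \<le> len_lam j v" by simp
  show ?case
  proof (cases "length z \<le> length v")
    case True
    then have "suffix z v" using "1.prems"(2) suffix_append_same_length by blast
    then have "len_lam j z \<le> len_lam j v" by (rule len_lam_suffix)
    then show ?thesis using fl3 fl_Suc_mono[of j] Tau_le by linarith
  next
    case long: False
    have vz: "suffix v z"
      using suffix_length_suffix[OF _ "1.prems"(2), of v] long by (simp add: suffix_def)
    show ?thesis
    proof (cases "Sigma \<in> set v")
      \<comment> \<open>If the period is a power of \<open>Tau\<close>, so is \<open>z\<close>, and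
        ttt = 0 leaves at most two letters. With \<open>fl (j + 3) \<le> 3 * fl (Suc j)\<close> this
        makes 2 + 3 = 5, the constant of the bound.\<close>
      case False
      then have "set z \<subseteq> {Tau}"
        using periodic_set[OF "1.prems"(2)] ab by (metis append_is_Nil_conv gen.exhaust
            insertCI list.distinct(1) subset_iff)
      then have z: "z = replicate (length z) Tau"
        by (simp add: replicate_eqI subset_iff)
      have "length z \<le> 2"
      proof (rule ccontr)
        assume "\<not> length z \<le> 2"
        then obtain m where "length z = 3 + m"
          by (metis le_Suc_ex not_less_eq_eq numeral_2_eq_2 numeral_3_eq_3)
        with z have "z = replicate (3 + m) Tau" by metis
        then have "z = [Tau, Tau, Tau] @ replicate m Tau" by (simp add: numeral_3_eq_3)
        then show False
          using "1.prems"(1) not_nonzero_Tau_Tau_Tau nonzero_sublist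
          by (metis prefix_def prefix_imp_sublist)
      qed
      moreover have "len_lam j (replicate n Tau) = n * fl (Suc j)" for n
        by (induction n) simp_all
      ultimately have "len_lam j z \<le> 2 * fl (Suc j)"
        using z by (metis mult_le_mono1)
      then show ?thesis using fl3 fl_Suc_mono[of j] Tau_le by linarith
    next
      case True
      \<comment> \<open>The extra \<open>fl j\<close> reserves room for a final \<open>Sigma\<close>
        that may have been removed. Only the length and the letters of \<open>v\<close> are
        prescribed for \<open>w\<close>, because that removal rotates the period.\<close>
      have step: "len_lam j x + fl j + fl (j + 3) \<le> 5 * len_lam j w"
        if x: "x = lamw x0" "nonzero x" "suffix x (x @ w)" "length w \<le> length x"
          and w: "length w = length v" "set w = set v" for x x0 w
      proof -
        obtain y w0 where y: "w = lamw w0" "nonzero y" "suffix y (y @ w0)"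
          "len_lam j x \<le> fl (Suc j) + len_lam (Suc j) y"
          using periodic_desubstitution[of x0 w] x by metis
        \<comment> \<open>A \<open>Sigma\<close> in the period comes from a \<open>Tau\<close> in
          its preimage, so the preimage is shorter.\<close>
        have "Tau \<in> set w0"
        proof (rule ccontr)
          assume "Tau \<notin> set w0"
          then have "Sigma \<notin> set (lamw w0)"
            by (auto simp: lamw_def split: gen.splits)
          then show False using y w True by simp
        qed
        moreover from this have "length w0 < length v"
          using length_lamw_less y w by metis
        ultimately have "len_lam (Suc j) y + fl (Suc j + 3) \<le> 5 * len_lam (Suc j) w0"
          using "1.IH" y(2,3) by blast
        then show ?thesis using y(1,4) fl4 by simp
      qed
      show ?thesis
        using "1.prems"(1)
      proof (cases rule: nonzero_decomposition)
        case (1 x0)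
        then show ?thesis using step[of z x0 v] \<open>nonzero z\<close> \<open>suffix z (z @ v)\<close> long by simp
      next
        case (2 x0)
        define x where "x = lamw x0"
        have zx: "z = x @ [Sigma]" using 2 x_def by simp
        have "v \<noteq> []" using ab by simp
        then obtain w where w: "v = w @ [Sigma]"
          using vz zx by (cases v rule: rev_cases) (auto simp: suffix_def)
        \<comment> \<open>Taking the final \<open>Sigma\<close> off \<open>z\<close> rotates the
          period from \<open>w @ [Sigma]\<close> to \<open>Sigma # w\<close>, of equal weighted
          length.\<close>
        have "suffix x (x @ Sigma # w)"
          using \<open>suffix z (z @ v)\<close> unfolding zx w by (auto simp: suffix_def)
        then have "len_lam j x + fl j + fl (j + 3) \<le> 5 * len_lam j (Sigma # w)"
          using step[of x x0 "Sigma # w"] 2 x_def long zx w by auto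
        then show ?thesis using zx w by simp
      qed
    qed
  qed
qed

text \<open>The periodic bound at level 0 would give
  \<open>5 * length w + 3 \<le> 5 * length w\<close>. Without a \<open>Tau\<close>, the fifth power
  contains ss.\<close>

lemma fifth_power_zero:
  assumes "w \<noteq> []"
  shows "\<not> nonzero (concat (replicate 5 w))"
proof
  assume *: "nonzero (concat (replicate 5 w))"
  show False
  proof (cases "Tau \<in> set w")
    case True
    have "suffix (concat (replicate 5 w)) (concat (replicate 5 w) @ w)"
      by (rule suffixI[of _ w]) (simp add: numeral_eq_Suc)
    from periodic_length_bound[OF * this True, of 0] show False
      by (simp add: numeral_eq_Suc fl_Suc_Suc)
  next
    case False
    obtain g x where "w = g # x" using assms by (cases w) auto
    have "w = replicate (length w) Sigma"
      using False by (metis gen.exhaust replicate_eqI)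
    then have "set w = {Sigma}" using assms by (metis length_0_conv set_replicate)
    define y where "y = concat (replicate 5 w)"
    have "set y \<subseteq> {Sigma}" unfolding y_def using \<open>set w = {Sigma}\<close> by (simp add: numeral_eq_Suc)
    moreover have "length y \<ge> 2" unfolding y_def \<open>w = g # x\<close> by (simp add: numeral_eq_Suc)
    ultimately obtain y' where "y = Sigma # Sigma # y'"
      by (cases y; cases "tl y") auto
    then show False using * nonzero_no_Sigma_Sigma
      unfolding y_def by (metis prefix_imp_sublist Cons_prefix_Cons prefix_order.order_refl prefix_bot.bot_least)
  qed
qed

text \<open>The word is a cyclic rotation of \<open>(lamw ^^ 4) [Sigma]\<close>; one basis word on
  which its fourth power survives is a certificate.\<close>

lemma fourth_power_nonzero: "nonzero (concat (replicate 4 [Tau, Sigma, Tau, Tau, Sigma]))"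
proof -
  have "act (concat (replicate 4 [Tau, Sigma, Tau, Tau, Sigma])) [Y2, Y2, Y1, Y1, Y1, Y2, Y2]
      = Some [Y1, Y1, Y1, Y2, Y1, Y1, Y1]"
    by (simp add: numeral_eq_Suc)
  then show ?thesis unfolding nonzero_def by blast
qed

section \<open>Relators as words\<close>

fun relw :: "nat \<Rightarrow> gen list" where
  "relw 0 = []"
| "relw (Suc 0) = [Sigma, Sigma]"
| "relw (Suc (Suc n)) = (if even n then Tau # lamw (relw (Suc n)) else lamw (relw (Suc n)))"

lemma prod_list_words: "prod_list (map (\<lambda>g. word (f g)) w) = (word (concat (map f w)) :: 'a free_ring)"
  by (induction w) (simp_all add: word_mult word_Nil)

lemma lam_word: "lam (word w) = word (lamw w)"
proof -
  have "case_gen tau (sigma * tau) = (\<lambda>g. word (case_gen [Tau] [Sigma, Tau] g) :: gen free_ring)"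
    by (auto simp: word_mult split: gen.split)
  then show ?thesis
    by (simp add: lam_def evaluate_single prod_list_words lamw_def)
qed

lemma relator_eq_relw: "n \<ge> 1 \<Longrightarrow> relator n = word (relw n)"
proof (induction n rule: relw.induct)
  case 2
  show ?case by (simp add: power2_eq_square word_mult)
next
  case (3 n)
  then show ?case by (simp add: lam_word word_mult)
qed simp

lemma relw_odd: "odd n \<Longrightarrow> \<exists>x. relw n = Sigma # x"
  and relw_even: "even n \<Longrightarrow> n \<noteq> 0 \<Longrightarrow> \<exists>x. relw n = Tau # Tau # x"
proof (induction n rule: relw.induct)
  case (3 n)
  { case 1
    then show ?case using "3.IH"(3,4) by (cases n) auto
  next
    case 2
    then show ?case using "3.IH"(1,2) by auto }
qed auto

text \<open>For a zero word \<open>u\<close>, \<open>lamw u\<close> can survive only if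
  \<open>u\<close> begins with \<open>Sigma\<close>. Odd relators do, but
  \<open>Tau # lamw u\<close> is \<open>lamw (Sigma # u)\<close>, both of whose readings contain
  \<open>u\<close>. Even relators begin with \<open>Tau\<close>.\<close>

lemma not_nonzero_relw: "n \<ge> 1 \<Longrightarrow> \<not> nonzero (relw n)"
proof (induction n rule: relw.induct)
  case 2
  show ?case by (simp add: not_nonzero_Sigma_Sigma)
next
  case (3 n)
  then have IH: "\<not> nonzero (relw (Suc n))" by auto
  show ?case
  proof (cases "even n")
    case True
    have "\<not> nonzero (lamw (Sigma # relw (Suc n)))"
      unfolding nonzero_lamw using IH nonzero_ConsD by blast
    then show ?thesis using True by simp
  next
    case False
    then obtain x where "relw (Suc n) = Tau # x" using relw_even[of "Suc n"] by auto
    then have "\<not> nonzero (lamw (relw (Suc n)))"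
      unfolding nonzero_lamw using IH by auto
    then show ?thesis using False by simp
  qed
qed simp

text \<open>Desubstitution leads to tails of earlier relators with the parities exchanged. It
  follows that an odd relator cannot begin \<open>Sigma # w\<close> while an even one begins
  \<open>Tau # w\<close>.\<close>

lemma relw_tails_incomparable:
  assumes "odd i" "even k" "relw i = Sigma # x" "relw k = Tau # y"
  shows "\<not> prefix x y \<and> \<not> prefix y x"
  using assms
proof (induction "i + k" arbitrary: i k x y rule: less_induct)
  case less
  obtain k' where k: "k = Suc (Suc k')" "even k'"
    using less.prems by (cases k rule: relw.cases) auto
  obtain y' where y': "relw (Suc k') = Sigma # y'" using relw_odd[of "Suc k'"] k by auto
  then have y: "y = Tau # lamw y'" using less.prems k by simp
  show ?case
  proof (cases i rule: relw.cases)
    case 2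
    then show ?thesis using less.prems y by auto
  next
    case (3 i')
    then have "odd i'" using less.prems by simp
    then obtain x' where x': "relw (Suc i') = Tau # x'" using relw_even[of "Suc i'"] by auto
    then have x: "x = Tau # lamw x'" using less.prems 3 \<open>odd i'\<close> by simp
    have "\<not> prefix y' x' \<and> \<not> prefix x' y'"
      using less.hyps[of "Suc k'" "Suc i'"] k 3 \<open>odd i'\<close> x' y' by simp
    then show ?thesis by (simp add: x y prefix_lamw_iff)
  qed (use less.prems in simp)
qed

definition has_relator :: "gen list \<Rightarrow> bool" where
  "has_relator w \<longleftrightarrow> (\<exists>n\<ge>1. sublist (relw n) w)"

text \<open>The successor of an even relator is its bare image. After an odd one an extra
  \<open>Tau\<close> stands in front, supplied by the last letter of \<open>lamw a\<close>.\<close>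

lemma has_relator_lamw:
  assumes "n \<ge> 1" "w = a @ relw n @ b" "even n \<or> a \<noteq> []"
  shows "has_relator (lamw w)"
proof -
  obtain m where m: "n = Suc m" using assms(1) by (cases n) auto
  have "sublist (relw (Suc n)) (lamw w)"
  proof (cases "even n")
    case True
    then show ?thesis using assms(2) m by (auto simp: sublist_def)
  next
    case False
    then obtain c where "lamw a = c @ [Tau]" using assms(3) lamw_snoc_Tau by blast
    then have "lamw w = c @ (Tau # lamw (relw n)) @ lamw b" using assms(2) by simp
    then show ?thesis using False m unfolding sublist_def by auto
  qed
  then show ?thesis unfolding has_relator_def by (intro exI[of _ "Suc n"]) simp
qed

text \<open>Both desubstitutions of a word strictly decrease this weight.\<close>

definition wt :: "gen list \<Rightarrow> nat" where
  "wt w = sum_list (map (case_gen 2 3) w)"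

lemma wt_simps [simp]: "wt [] = 0" "wt (Sigma # w) = 2 + wt w" "wt (Tau # w) = 3 + wt w"
  "wt (u @ w) = wt u + wt w"
  by (simp_all add: wt_def)

lemma wt_lamw: "w \<noteq> [] \<Longrightarrow> wt w < wt (lamw w)"
proof (induction w)
  case (Cons g w)
  then show ?case by (cases g; cases "w = []") auto
qed simp

text \<open>Descent along desubstitution: a relator in the preimage yields the next relator in the
  word. The one exception is an odd relator at the very front of the preimage.\<close>

lemma zero_has_relator: "\<not> nonzero w \<Longrightarrow> has_relator w"
proof (induction "wt w" arbitrary: w rule: less_induct)
  case less
  show ?case
  proof (cases "sublist [Sigma, Sigma] w")
    case True
    then show ?thesis unfolding has_relator_def by (intro exI[of _ 1]) simp
  next
    case False
    then obtain w0 where w0: "sublist (lamw w0) w" "\<not> nonzero (lamw w0)" "wt (lamw w0) \<le> wt w"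
    proof (cases rule: lamw_decomposition[OF False])
      case (1 w0)
      then show ?thesis using that[of w0] less.prems by simp
    next
      case (2 w0)
      then have "sublist (lamw w0) w" by (auto simp: prefix_imp_sublist)
      then show ?thesis using that[of w0] 2 less.prems by (simp add: nonzero_lamw_Sigma)
    qed
    have "w0 \<noteq> []" using w0(2) by auto
    then have wt0: "wt w0 < wt w" using wt_lamw w0(3) by (meson order_less_le_trans)
    have nz0: "\<not> nonzero w0" using w0(2) nonzero_lamw by blast
    obtain n a b where n: "n \<ge> 1" "w0 = a @ relw n @ b"
      using less.hyps[OF wt0 nz0] by (auto simp: has_relator_def sublist_def)
    have "has_relator (lamw w0)"
    proof (cases "even n \<or> a \<noteq> []")
      case True
      then show ?thesis using has_relator_lamw n by blast
    next
      case False
      then obtain p where p: "relw n = Sigma # p" using relw_odd by blast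
      define w' where "w' = p @ b"
      have w': "w0 = Sigma # w'" using n(2) False p w'_def by simp
      \<comment> \<open>The second reading of \<open>w0\<close> must vanish too, and so contains a
        relator itself.\<close>
      then have "\<not> nonzero (Tau # w')" using w0(2) nonzero_lamw by blast
      \<comment> \<open>For an empty \<open>w'\<close> the words \<open>Tau # w'\<close> and
        \<open>lamw w0\<close> would coincide, and the weight would not drop.\<close>
      moreover have "w' \<noteq> []" using nz0 w' by auto
      then have "wt (Tau # w') < wt w" using wt_lamw[of w'] w0(3) w' by simp
      ultimately have "has_relator (Tau # w')" using less.hyps by blast
      then obtain k c d where k: "k \<ge> 1" "Tau # w' = c @ relw k @ d"
        unfolding has_relator_def sublist_def by blast
      show ?thesis
      proof (cases "c = []")
        \<comment> \<open>Both readings would begin with a relator, against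
          \<open>relw_tails_incomparable\<close>.\<close>
        case True
        have "even k"
        proof (rule ccontr)
          assume "odd k"
          then show False using relw_odd[of k] k True by auto
        qed
        then obtain q where q: "relw k = Tau # q" using relw_even[of k] k by auto
        then have "p @ b = q @ d" using k True w'_def by simp
        then have "prefix p q \<or> prefix q p"
          by (metis prefixI prefix_same_cases)
        then show ?thesis
          using relw_tails_incomparable[of n k p q] False \<open>even k\<close> p q by auto
      next
        \<comment> \<open>The relator lies inside \<open>w'\<close>, hence has a left neighbour in
          \<open>w0\<close>.\<close>
        case False
        then obtain c' where "w0 = (Sigma # c') @ relw k @ d"
          using k w' by (cases c) auto
        then show ?thesis using has_relator_lamw k by blast
      qed
    qed
    then show ?thesis
      using w0(1) unfolding has_relator_def by (meson sublist_order.order_trans)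
  qed
qed

section \<open>Words as operators\<close>

abbreviation gen_op :: "gen \<Rightarrow> operator" where
  "gen_op \<equiv> case_gen s_op t_op"

abbreviation opw :: "gen list \<Rightarrow> operator" where
  "opw w \<equiv> prod_list (map gen_op w)"

definition opt_word :: "letter list option \<Rightarrow> vec" where
  "opt_word x = (case x of None \<Rightarrow> 0 | Some v \<Rightarrow> word v)"

lemma opt_word_simps [simp]: "opt_word None = 0" "opt_word (Some v) = word v"
  by (simp_all add: opt_word_def)

lemma app_add_right: "app L (v + w) = app L v + app L w"
  using app[of L] by (simp add: linear_scale_iff)

lemma app_zero_right [simp]: "app L 0 = 0"
  using app_add_right[of L 0 0] by simp

lemma app_zero [simp]: "app 0 v = 0"
  by (simp add: zero_operator.rep_eq)

lemma app_add: "app (L + M) v = app L v + app M v"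
  by (simp add: plus_operator.rep_eq)

lemma app_sum: "app (sum f A) v = (\<Sum>x\<in>A. app (f x) v)"
  by (induction A rule: infinite_finite_induct) (simp_all add: app_add)

lemma s_word_eq: "s_word u = opt_word (s_step u)"
  by (cases u rule: s_step.cases) simp_all

lemma t_word_eq: "t_word u = opt_word (t_step u)"
proof (induction u rule: t_step.induct)
  case (2 u)
  then show ?case by (cases "t_step u") (simp_all add: word_mult)
next
  case (3 u)
  then show ?case by (cases "s_step u") (simp_all add: s_word_eq word_mult)
qed simp

lemma app_opw: "app (opw w) (word u) = opt_word (act w u)"
proof (induction w arbitrary: u)
  case (Cons g w)
  show ?case
  proof (cases g)
    case Sigma
    then show ?thesis using Cons.IH
      by (cases "s_step u") (simp_all add: times_operator.rep_eq s_op.rep_eq s_word_eq)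
  next
    case Tau
    then show ?thesis using Cons.IH
      by (cases "t_step u") (simp_all add: times_operator.rep_eq t_op.rep_eq t_word_eq)
  qed
qed (simp add: one_operator.rep_eq)

lemma word_neq_zero: "(word v :: vec) \<noteq> 0"
  by (metis lookup_single_eq lookup_zero zero_neq_one)

lemma opw_eq_0_iff: "opw w = 0 \<longleftrightarrow> \<not> nonzero w"
proof
  assume "opw w = 0"
  then have "opt_word (act w u) = 0" for u using app_opw[of w u] by simp
  then have "act w u = None" for u by (metis not_None_eq opt_word_simps(2) word_neq_zero)
  then show "\<not> nonzero w" by (simp add: nonzero_def)
next
  assume "\<not> nonzero w"
  then have "act w u = None" for u by (auto simp: nonzero_def)
  then show "opw w = 0" by (intro operator_eqI) (simp add: app_opw)
qed

text \<open>Rational scalars make dimension theory available for bounding ranks over the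
  integers.\<close>

lift_definition scale_op :: "rat \<Rightarrow> operator \<Rightarrow> operator" is "\<lambda>c f v. scale c (f v)"
  by (simp add: linear_scale_iff vec.scale_right_distrib mult.commute)

interpretation op: vector_space scale_op
  by standard (transfer; simp add: vec.scale_right_distrib vec.scale_left_distrib)+

lemma of_int_mult_eq_scale_op: "of_int k * L = scale_op (of_int k) L"
proof (induction k rule: int_induct[where k = 0])
  case (step1 i)
  then show ?case by (simp add: distrib_right op.scale_left_distrib)
next
  case (step2 i)
  then show ?case by (simp add: left_diff_distrib op.scale_left_diff_distrib)
qed simp

lemma lookup_opw:
  "Poly_Mapping.lookup (app (opw w) (word u)) v = (if act w u = Some v then 1 else 0)"
  by (cases "act w u") (auto simp: app_opw lookup_single)

text \<open>By \<open>act_unique\<close> no other word sends \<open>u\<close> to \<open>v\<close>,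
  so one matrix coefficient reads off the coefficient of \<open>w\<close> in every linear
  combination.\<close>

lemma nonzero_coefficient:
  assumes "nonzero w"
  obtains u v where "\<And>A c. finite A \<Longrightarrow>
    Poly_Mapping.lookup (app (\<Sum>x\<in>A. scale_op (c x) (opw x)) (word u)) v = (if w \<in> A then c w else 0)"
proof -
  obtain u v where uv: "act w u = Some v" using assms by (auto simp: nonzero_def)
  have "act x u = Some v \<longleftrightarrow> x = w" for x
    using act_unique uv by blast
  then have "Poly_Mapping.lookup (app (\<Sum>x\<in>A. scale_op (c x) (opw x)) (word u)) v
      = (if w \<in> A then c w else 0)" if "finite A" for A c
    using that by (simp add: app_sum lookup_sum scale_op.rep_eq lookup_opw if_distrib cong: if_cong)
  then show ?thesis by (rule that)
qed

section \<open>The presentation\<close>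

lemma evaluate_diff: "evaluate f (p - q) = evaluate f p - evaluate f q"
  using evaluate_add[of f "p - q" q] by simp

text \<open>By \<open>nonzero_coefficient\<close> there is no cancellation between nonzero words;
  this makes the presentation monomial.\<close>

lemma evaluate_gen_op_eq_0_iff:
  "evaluate gen_op p = 0 \<longleftrightarrow> (\<forall>w\<in>Poly_Mapping.keys p. \<not> nonzero w)"
proof
  assume *: "evaluate gen_op p = 0"
  show "\<forall>w\<in>Poly_Mapping.keys p. \<not> nonzero w"
  proof (intro ballI notI)
    fix w assume w: "w \<in> Poly_Mapping.keys p" "nonzero w"
    have eq: "evaluate gen_op p =
        (\<Sum>x\<in>Poly_Mapping.keys p. scale_op (of_int (Poly_Mapping.lookup p x)) (opw x))"
      by (simp add: evaluate_def of_int_mult_eq_scale_op)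
    obtain u v where "Poly_Mapping.lookup (app (\<Sum>x\<in>Poly_Mapping.keys p.
        scale_op (of_int (Poly_Mapping.lookup p x)) (opw x)) (word u)) v
        = rat_of_int (Poly_Mapping.lookup p w)"
      using nonzero_coefficient[OF w(2)] w(1) finite_keys by metis
    then have "rat_of_int (Poly_Mapping.lookup p w) = 0"
      using * eq by simp
    then show False using w(1) by (simp add: in_keys_iff)
  qed
next
  assume "\<forall>w\<in>Poly_Mapping.keys p. \<not> nonzero w"
  then show "evaluate gen_op p = 0"
    unfolding evaluate_def by (intro sum.neutral ballI) (metis opw_eq_0_iff mult_zero_right)
qed

lemma mu_R2_eq: "mu_R2 = {opw w | w. w \<noteq> []}"
proof
  have "{s_op, t_op} \<subseteq> {opw w | w. w \<noteq> []}"
  proof -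
    have "s_op = opw [Sigma]" "t_op = opw [Tau]" by simp_all
    then show ?thesis by blast
  qed
  moreover have "is_mult_semigroup {opw w | w. w \<noteq> []}"
    unfolding is_mult_semigroup_def
    by (auto, metis append_is_Nil_conv map_append prod_list.append)
  ultimately show "mu_R2 \<subseteq> {opw w | w. w \<noteq> []}"
    unfolding mu_R2_def by (rule hull_minimal)
  have mu: "is_mult_semigroup mu_R2"
    unfolding mu_R2_def by (rule hull_in) (auto simp: is_mult_semigroup_def)
  have gen: "gen_op g \<in> mu_R2" for g
    using hull_subset[of "{s_op, t_op}" is_mult_semigroup] unfolding mu_R2_def
    by (cases g) auto
  have "opw w \<in> mu_R2" if "w \<noteq> []" for w
    using that
  proof (induction w rule: list_nonempty_induct)
    case (single g)
    then show ?case using gen by simp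
  next
    case (cons g w)
    then show ?case using mu gen by (simp add: is_mult_semigroup_def)
  qed
  then show "{opw w | w. w \<noteq> []} \<subseteq> mu_R2" by blast
qed

text \<open>The constant term is the value at the origin, which makes it multiplicative.\<close>

lemma free_rng_eq: "(free_rng :: 'g free_ring set) = {p. evaluate (\<lambda>_. 0 :: int) p = 0}"
proof -
  have "evaluate (\<lambda>_. 0 :: int) p = Poly_Mapping.lookup p []" for p :: "'g free_ring"
  proof -
    have eq: "prod_list (map (\<lambda>_. 0 :: int) w) = (if w = [] then 1 else 0)" for w :: "'g list"
      by (cases w) auto
    show ?thesis
      unfolding evaluate_def eq by (simp add: if_distrib in_keys_iff cong: if_cong)
  qed
  then show ?thesis by (simp add: free_rng_def)
qed

lemma evaluate_free_rng: "evaluate gen_op ` free_rng = R2"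
proof
  show "evaluate gen_op ` free_rng \<subseteq> R2"
  proof clarify
    fix p :: "gen free_ring" assume p: "p \<in> free_rng"
    have "of_int (Poly_Mapping.lookup p w) * opw w \<in> R2" if "w \<in> Poly_Mapping.keys p" for w
    proof -
      have "w \<noteq> []" using that p by (auto simp: free_rng_def in_keys_iff)
      then have "opw w \<in> mu_R2" by (auto simp: mu_R2_eq)
      then show ?thesis unfolding R2_eq_span
        by (intro int_module.span_scale int_module.span_base)
    qed
    then show "evaluate gen_op p \<in> R2"
      unfolding evaluate_def R2_eq_span by (intro int_module.span_sum)
  qed
  show "R2 \<subseteq> evaluate gen_op ` free_rng"
  proof
    fix x assume "x \<in> R2"
    then have "x \<in> int_module.span mu_R2" by (simp add: R2_eq_span)
    then show "x \<in> evaluate gen_op ` free_rng"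
    proof (induction rule: int_module.span_induct_alt)
      case base
      have "0 \<in> (free_rng :: gen free_ring set)" by (simp add: free_rng_def)
      then show ?case by force
    next
      case (step c z y)
      then obtain w p where w: "z = opw w" "w \<noteq> []" and p: "p \<in> free_rng" "y = evaluate gen_op p"
        by (auto simp: mu_R2_eq)
      then have "Poly_Mapping.single w c + p \<in> free_rng"
        by (simp add: free_rng_def lookup_add lookup_single)
      moreover have "of_int c * z + y = evaluate gen_op (Poly_Mapping.single w c + p)"
        using w p by (simp add: evaluate_add evaluate_single)
      ultimately show ?case by blast
    qed
  qed
qed

lemma kernel_is_ideal:
  "is_ideal_of free_rng {p \<in> free_rng. evaluate gen_op p = 0}"
  unfolding is_ideal_of_def free_rng_eq by (auto simp: evaluate_diff evaluate_mult)

lemma is_ideal_of_add: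
  assumes "is_ideal_of R I" "x \<in> I" "y \<in> I"
  shows "x + y \<in> I"
proof -
  have "x - (0 - y) \<in> I" using assms unfolding is_ideal_of_def by blast
  then show ?thesis by simp
qed

lemma word_in_free_rng: "w \<noteq> [] \<Longrightarrow> word w \<in> free_rng"
  by (simp add: free_rng_def lookup_single)

lemma kernel_subset_ideal:
  assumes I: "is_ideal_of free_rng I" and U: "{relator i | i. i \<ge> 1} \<subseteq> I"
    and p: "evaluate gen_op p = 0"
  shows "p \<in> I"
proof -
  have zero: "0 \<in> I" using I by (simp add: is_ideal_of_def)
  have wordI: "word w \<in> I" if "\<not> nonzero w" for w
  proof -
    obtain n a b where n: "n \<ge> 1" "w = a @ relw n @ b"
      using zero_has_relator[OF \<open>\<not> nonzero w\<close>] by (auto simp: has_relator_def sublist_def)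
    have "word (relw n) \<in> I" using U n(1) relator_eq_relw by force
    \<comment> \<open>\<open>free_rng\<close> has no unit, so an empty cofactor is a separate
      case.\<close>
    then have "word (relw n @ b) \<in> I"
      using I word_in_free_rng[of b] unfolding is_ideal_of_def
      by (cases "b = []") (auto simp: word_mult[symmetric])
    then show ?thesis
      using I word_in_free_rng[of a] n(2) unfolding is_ideal_of_def
      by (cases "a = []") (auto simp: word_mult[symmetric])
  qed
  have singleI: "Poly_Mapping.single w k \<in> I" if "\<not> nonzero w" for w k
  proof (induction k rule: int_induct[where k = 0])
    case base
    then show ?case using zero by simp
  next
    case (step1 i)
    then show ?case
      using is_ideal_of_add[OF I _ wordI[OF that]] by (simp add: single_add)
  next
    case (step2 i)
    then have "Poly_Mapping.single w i - word w \<in> I"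
      using I wordI[OF that] by (simp add: is_ideal_of_def)
    then show ?case by (simp add: single_diff)
  qed
  have "(\<Sum>w\<in>A. Poly_Mapping.single w (Poly_Mapping.lookup p w)) \<in> I"
    if "finite A" "A \<subseteq> Poly_Mapping.keys p" for A
    using that
  proof (induction A rule: finite_induct)
    case (insert w A)
    then show ?case
      using is_ideal_of_add[OF I] singleI p evaluate_gen_op_eq_0_iff by auto
  qed (use zero in simp)
  then show ?thesis using free_ring_expansion[of p] by (metis finite_keys order_refl)
qed

lemma R2_presentation: "affords_presentation R2 gen_op {relator i | i. i \<ge> 1}"
proof -
  have "{p \<in> free_rng. evaluate gen_op p = 0} = is_ideal_of free_rng hull {relator i | i. i \<ge> 1}"
  proof
    show "{p \<in> free_rng. evaluate gen_op p = 0} \<subseteq> is_ideal_of free_rng hull {relator i | i. i \<ge> 1}"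
      unfolding hull_def using kernel_subset_ideal by blast
    have "relator i \<in> {p \<in> free_rng. evaluate gen_op p = 0}" if "i \<ge> 1" for i
    proof -
      have "relw i \<noteq> []" using not_nonzero_relw[OF that] by auto
      then show ?thesis using that not_nonzero_relw[OF that]
        by (simp add: relator_eq_relw word_in_free_rng evaluate_single opw_eq_0_iff)
    qed
    then show "is_ideal_of free_rng hull {relator i | i. i \<ge> 1} \<subseteq> {p \<in> free_rng. evaluate gen_op p = 0}"
      using kernel_is_ideal by (intro hull_minimal) blast+
  qed
  then show ?thesis
    unfolding affords_presentation_def using evaluate_free_rng by blast
qed

section \<open>Nilpotency of the multiplicative semigroup\<close>

lemma opw_power: "opw w ^ n = opw (concat (replicate n w))"
  by (induction n) simp_all

lemma mu_R2_nil_of_degree_5: "(\<forall>w\<in>mu_R2. w ^ 5 = 0) \<and> (\<exists>w\<in>mu_R2. w ^ 4 \<noteq> 0)"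
proof
  show "\<forall>w\<in>mu_R2. w ^ 5 = 0"
    using fifth_power_zero by (auto simp: mu_R2_eq opw_power opw_eq_0_iff)
  have "opw [Tau, Sigma, Tau, Tau, Sigma] ^ 4 \<noteq> 0"
    unfolding opw_power opw_eq_0_iff using fourth_power_nonzero by simp
  then show "\<exists>w\<in>mu_R2. w ^ 4 \<noteq> 0"
    unfolding mu_R2_eq by blast
qed

lemma relator_is_word: "i \<ge> 1 \<Longrightarrow> \<exists>w. w \<noteq> [] \<and> relator i = word w"
  using relator_eq_relw not_nonzero_relw nonzero_Nil by metis

section \<open>The rank as a number of words\<close>

definition nonzero_words :: "nat \<Rightarrow> gen list set" where
  "nonzero_words n = {w. w \<noteq> [] \<and> nonzero w \<and> length w \<le> n}"

lemma finite_nonzero_words: "finite (nonzero_words n)"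
proof -
  have "finite {w :: gen list. set w \<subseteq> {Sigma, Tau} \<and> length w \<le> n}"
    by (rule finite_lists_length_le) simp
  moreover have "nonzero_words n \<subseteq> {w. set w \<subseteq> {Sigma, Tau} \<and> length w \<le> n}"
    unfolding nonzero_words_def using gen.exhaust by blast
  ultimately show ?thesis by (rule rev_finite_subset)
qed

lemma inj_on_opw: "inj_on opw {w. nonzero w}"
proof (rule inj_onI)
  fix w x assume *: "w \<in> {w. nonzero w}" "opw w = opw x"
  then obtain u v where uv: "act w u = Some v" by (auto simp: nonzero_def)
  have "act x u = Some v"
    using lookup_opw[of w u v] lookup_opw[of x u v] *(2) uv by (simp split: if_splits)
  then show "w = x" using act_unique uv by blast
qed

lemma independent_opw: "op.independent (opw ` nonzero_words n)"
proof
  assume "op.dependent (opw ` nonzero_words n)"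
  then obtain T c x where T: "finite T" "T \<subseteq> opw ` nonzero_words n" and c: "(\<Sum>x\<in>T. scale_op (c x) x) = 0"
    and x: "x \<in> T" "c x \<noteq> 0"
    unfolding op.dependent_explicit by blast
  obtain A where A: "A \<subseteq> nonzero_words n" "T = opw ` A"
    using T(2) by (meson subset_image_iff)
  have fin: "finite A" using A(1) finite_nonzero_words finite_subset by blast
  have "inj_on opw A" using inj_on_opw A(1) unfolding nonzero_words_def inj_on_def by blast
  then have sum: "(\<Sum>w\<in>A. scale_op (c (opw w)) (opw w)) = 0"
    using c A(2) by (simp add: sum.reindex)
  obtain w where w: "w \<in> A" "x = opw w" using x(1) A(2) by blast
  then have "nonzero w" using A(1) by (auto simp: nonzero_words_def)
  then obtain u v where "\<And>A c. finite A \<Longrightarrow>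
      Poly_Mapping.lookup (app (\<Sum>x\<in>A. scale_op (c x) (opw x)) (word u)) v = (if w \<in> A then c w else 0)"
    using nonzero_coefficient by metis
  from this[OF fin, of "\<lambda>w. c (opw w)"] have "c (opw w) = 0"
    using sum w(1) by simp
  then show False using x w by simp
qed

lemma common_denominator:
  fixes c :: "'a \<Rightarrow> rat"
  assumes "finite T"
  obtains d :: int where "d \<noteq> 0" "\<And>x. x \<in> T \<Longrightarrow> of_int d * c x \<in> \<int>"
proof -
  have "\<exists>d :: int. d \<noteq> 0 \<and> (\<forall>x\<in>T. of_int d * c x \<in> \<int>)"
    using assms
  proof (induction T)
    case (insert y T)
    then obtain d :: int where d: "d \<noteq> 0" "\<forall>x\<in>T. of_int d * c x \<in> \<int>" by blast
    obtain a b :: int where ab: "c y = of_int a / of_int b" "b \<noteq> 0"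
      by (metis quotient_of_div quotient_of_denom_pos less_irrefl surj_pair)
    have "of_int (b * d) * c x \<in> \<int>" if "x \<in> insert y T" for x
    proof (cases "x = y")
      case True
      then have "of_int (b * d) * c x = of_int (d * a)" using ab by simp
      then show ?thesis by (metis Ints_of_int)
    next
      case False
      then have "of_int d * c x \<in> \<int>" using d that by blast
      then have "of_int b * (of_int d * c x) \<in> \<int>" by (rule Ints_mult[OF Ints_of_int])
      then show ?thesis by (simp only: of_int_mult mult.assoc)
    qed
    moreover have "b * d \<noteq> 0" using ab d by simp
    ultimately show ?case by blast
  qed (auto intro: exI[of _ 1])
  then show ?thesis using that by blast
qed

text \<open>Clearing denominators turns a rational relation into an integral one.\<close>

lemma int_independent_iff: "int_module.independent B \<longleftrightarrow> op.independent B"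
proof -
  have "op.dependent B" if dep: "int_module.dependent B"
  proof -
    obtain T c x where "finite T" "T \<subseteq> B" "(\<Sum>x\<in>T. of_int (c x) * x) = 0"
      and x: "x \<in> T" "c x \<noteq> 0"
      using dep unfolding int_module.dependent_explicit by blast
    moreover from this have "(\<Sum>x\<in>T. scale_op (of_int (c x)) x) = 0"
      by (simp only: of_int_mult_eq_scale_op)
    moreover have "(of_int (c x) :: rat) \<noteq> 0" using x(2) by simp
    ultimately show ?thesis
      unfolding op.dependent_explicit using x(1)
      by (intro exI[of _ T] exI[of _ "\<lambda>x. of_int (c x)"] conjI bexI[of _ x])
  qed
  moreover have "int_module.dependent B" if dep: "op.dependent B"
  proof -
    obtain T c y where T: "finite T" "T \<subseteq> B" and c: "(\<Sum>x\<in>T. scale_op (c x) x) = 0"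
      and y: "y \<in> T" "c y \<noteq> 0"
      using dep unfolding op.dependent_explicit by blast
    obtain d :: int where d: "d \<noteq> 0" "\<And>x. x \<in> T \<Longrightarrow> of_int d * c x \<in> \<int>"
      using common_denominator[OF T(1)] by metis
    define k where "k x = \<lfloor>of_int d * c x\<rfloor>" for x
    have k: "of_int (k x) = of_int d * c x" if "x \<in> T" for x
      unfolding k_def using d(2)[OF that] by simp
    have "(\<Sum>x\<in>T. of_int (k x) * x) = (\<Sum>x\<in>T. scale_op (of_int d * c x) x)"
      by (intro sum.cong refl) (simp add: of_int_mult_eq_scale_op k)
    also have "\<dots> = scale_op (of_int d) (\<Sum>x\<in>T. scale_op (c x) x)"
      by (simp add: op.scale_sum_right)
    finally have "(\<Sum>x\<in>T. of_int (k x) * x) = 0" using c by simp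
    moreover have "k y \<noteq> 0"
      using k[OF y(1)] y(2) d(1) by (metis mult_eq_0_iff of_int_0 of_int_eq_0_iff)
    ultimately show ?thesis
      unfolding int_module.dependent_explicit using T y(1)
      by (intro exI[of _ T] exI[of _ k] conjI bexI[of _ y])
  qed
  ultimately show ?thesis by blast
qed

lemma products_upto_eq:
  "products_upto {s_op, t_op} n = {opw w | w. w \<noteq> [] \<and> length w \<le> n}"
proof -
  have "(\<exists>w. xs = map gen_op w) \<longleftrightarrow> set xs \<subseteq> {s_op, t_op}" for xs
  proof -
    have "(\<exists>g. x = gen_op g) \<longleftrightarrow> x \<in> {s_op, t_op}" for x
      by (metis gen.exhaust gen.simps(3,4) insert_iff singletonD)
    then show ?thesis by (auto simp: ex_map_conv)
  qed
  then show ?thesis unfolding products_upto_def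
    by (smt (verit, ccfv_threshold) Collect_cong length_map list.map_disc_iff)
qed

text \<open>All products lie in the rational span of the independent nonzero words, which bounds the
  size of any independent set.\<close>

lemma Z_rank_eq_card:
  "Z_rank (int_module.span (products_upto {s_op, t_op} n)) = card (nonzero_words n)"
proof -
  let ?S = "products_upto {s_op, t_op} n" and ?B = "opw ` nonzero_words n"
  have card: "card ?B = card (nonzero_words n)"
    by (intro card_image inj_on_subset[OF inj_on_opw]) (auto simp: nonzero_words_def)
  have fin: "finite ?B" using finite_nonzero_words by blast
  have span: "int_module.span ?S \<subseteq> op.span ?B"
  proof (rule int_module.span_minimal)
    show "?S \<subseteq> op.span ?B"
    proof
      fix x assume "x \<in> ?S"
      then obtain w where w: "x = opw w" "w \<noteq> []" "length w \<le> n"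
        by (auto simp: products_upto_eq)
      show "x \<in> op.span ?B"
      proof (cases "nonzero w")
        case True
        then show ?thesis using w by (intro op.span_base) (auto simp: nonzero_words_def)
      next
        case False
        then show ?thesis using w opw_eq_0_iff op.span_zero by metis
      qed
    qed
    show "int_module.subspace (op.span ?B)"
      unfolding int_module.subspace_def
      by (auto simp: op.span_zero op.span_add op.span_scale of_int_mult_eq_scale_op)
  qed
  show ?thesis
    unfolding Z_rank_def
  proof (rule cSup_eq_maximum)
    have "?B \<subseteq> ?S" by (auto simp: products_upto_eq nonzero_words_def)
    then have "?B \<subseteq> int_module.span ?S" using int_module.span_superset by blast
    then show "card (nonzero_words n)
        \<in> {card B |B. B \<subseteq> int_module.span ?S \<and> finite B \<and> int_module.independent B}"
      using fin card independent_opw int_independent_iff by (intro CollectI exI[of _ ?B]) simp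
  next
    fix k assume "k \<in> {card B |B. B \<subseteq> int_module.span ?S \<and> finite B \<and> int_module.independent B}"
    then obtain B where "k = card B" "B \<subseteq> op.span ?B" "op.independent B"
      using span int_independent_iff by blast
    then show "k \<le> card (nonzero_words n)"
      using op.independent_span_bound[OF fin] card by simp
  qed
qed

section \<open>Counting nonzero words\<close>

text \<open>
  The nonzero words are the suffixes of the words \<^term>\<open>mw e\<close>, which are the products
  of distinct Fibonacci words in descending order.
\<close>

fun mw :: "bool list \<Rightarrow> gen list" where
  "mw [] = []"
| "mw (b # e) = lamw (mw e) @ (if b then [Sigma] else [])"

definition fibw :: "nat \<Rightarrow> gen list" where
  "fibw j = (lamw ^^ j) [Sigma]"

lemma length_fibw: "length (fibw j) = fl j"
  by (simp only: fibw_def fl_def len_lam_def)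

lemma fibw_Suc: "fibw (Suc j) = lamw (fibw j)"
  by (simp add: fibw_def)

lemma fibw_Suc_Suc: "fibw (Suc (Suc j)) = fibw j @ fibw (Suc j)"
  by (induction j) (simp_all add: fibw_Suc, simp add: fibw_def)

lemma fibw_neq_Nil [simp]: "fibw j \<noteq> []"
  by (induction j) (simp_all add: fibw_Suc, simp add: fibw_def)

lemma nonzero_mw: "nonzero (mw e)"
proof (induction e)
  case (Cons b e)
  then show ?case using nonzero_lamw nonzero_lamw_Sigma by (cases b) auto
qed simp

lemma suffix_lamw_mono: "suffix x y \<Longrightarrow> suffix (lamw x) (lamw y)"
  by (auto simp: suffix_def)

text \<open>Even if only the second reading \<open>Tau # w'\<close> of a preimage
  \<open>Sigma # w'\<close> survives, \<open>lamw (Sigma # w')\<close> is a suffix of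
  \<open>lamw (Tau # w')\<close>.\<close>

lemma nonzero_suffix_mw: "nonzero w \<Longrightarrow> \<exists>e. suffix w (mw e)"
proof (induction "wt w" arbitrary: w rule: less_induct)
  case less
  obtain w0 b where w: "w = lamw w0 @ (if b then [Sigma] else [])" "nonzero (lamw w0)"
    using less.prems by (cases rule: nonzero_decomposition) (metis append_Nil2, metis)
  have "\<exists>e. suffix (lamw w0) (lamw (mw e))"
  proof (cases "w0 = []")
    case False
    have wt: "wt (lamw w0) \<le> wt w" using w by simp
    show ?thesis
    proof (cases "nonzero w0")
      case True
      have "wt w0 < wt w" using wt_lamw[OF False] wt by simp
      then show ?thesis using less.hyps True suffix_lamw_mono by blast
    next
      case not: False
      then obtain w' where w': "w0 = Sigma # w'" "nonzero (Tau # w')"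
        using w(2) nonzero_lamw by blast
      then have "w' \<noteq> []" using not by auto
      then have "wt (Tau # w') < wt w" using wt_lamw[of w'] w' wt by simp
      then obtain e where "suffix (Tau # w') (mw e)" using less.hyps w' by blast
      then have "suffix (lamw (Tau # w')) (lamw (mw e))" by (rule suffix_lamw_mono)
      then have "suffix (lamw w0) (lamw (mw e))"
        using w' by (auto dest: suffix_ConsD)
      then show ?thesis by blast
    qed
  qed simp
  then obtain e where "suffix (lamw w0) (lamw (mw e))" by blast
  then have "suffix w (mw (b # e))" using w by auto
  then show ?case by blast
qed

section \<open>Upper bound for the number of nonzero words\<close>

lemma mw_append: "mw (d @ e) = (lamw ^^ length d) (mw e) @ mw d"
  by (induction d) simp_all

lemma mw_replicate_False: "mw (replicate n False) = []"
  by (induction n) simp_all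

lemma suffix_fibw_Suc: "j \<ge> 1 \<Longrightarrow> suffix (fibw j) (fibw (Suc j))"
  by (cases j) (auto simp: fibw_Suc_Suc suffix_def)

text \<open>The last letter of \<open>x\<close> contributes \<open>fibw j\<close> or
  \<open>fibw (Suc j)\<close>, and for j \<ge> 1 both end in \<open>fibw j\<close>.\<close>

lemma suffix_fibw_funpow:
  assumes "x \<noteq> []" "j \<ge> 1"
  shows "suffix (fibw j) ((lamw ^^ j) x)"
proof -
  obtain y g where x: "x = y @ [g]" using assms(1) by (cases x rule: rev_cases) auto
  have "(lamw ^^ j) [Tau] = fibw (Suc j)"
    by (simp only: fibw_def funpow_Suc_right comp_def lamw_simps)
  then have "suffix (fibw j) ((lamw ^^ j) [g])"
    using suffix_fibw_Suc[OF assms(2)] by (cases g) (simp_all add: fibw_def)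
  then show ?thesis unfolding x funpow_lamw_append by (rule suffix_appendI)
qed

text \<open>A word no longer than \<open>fibw j\<close> sees only the lowest \<open>j\<close> bits:
  the higher ones contribute a word that, unless empty, ends in \<open>fibw j\<close>.\<close>

lemma nonzero_suffix_fibw_mw:
  assumes "nonzero w" "length w \<le> fl j" "j \<ge> 1"
  obtains e where "length e = j" "suffix w (fibw j @ mw e)"
proof -
  obtain e where e: "suffix w (mw e)" using nonzero_suffix_mw[OF assms(1)] by blast
  \<comment> \<open>Padding with zero bits ensures that there are \<open>j\<close> lowest bits to
    take.\<close>
  define e1 where "e1 = e @ replicate j False"
  have "mw e1 = mw e" by (simp add: e1_def mw_append mw_replicate_False)
  moreover have len: "length (take j e1) = j" by (simp add: e1_def)
  moreover have "mw e1 = (lamw ^^ length (take j e1)) (mw (drop j e1)) @ mw (take j e1)"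
    using mw_append[of "take j e1" "drop j e1"] by (simp only: append_take_drop_id)
  ultimately have w: "suffix w ((lamw ^^ j) (mw (drop j e1)) @ mw (take j e1))"
    using e by metis
  have "suffix w (fibw j @ mw (take j e1))"
  proof (cases "mw (drop j e1) = []")
    case True
    then show ?thesis using w by (simp add: suffix_appendI)
  next
    case False
    then obtain y where "(lamw ^^ j) (mw (drop j e1)) = y @ fibw j"
      using suffix_fibw_funpow[OF _ assms(3)] by (auto simp: suffix_def)
    then have "suffix w (y @ (fibw j @ mw (take j e1)))" using w by simp
    then show ?thesis
      by (rule suffix_append_same_length) (simp add: length_fibw trans_le_add1 assms(2))
  qed
  then show ?thesis using that len by blast
qed

definition last_n :: "nat \<Rightarrow> 'a list \<Rightarrow> 'a list" where
  "last_n l w = drop (length w - l) w"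

lemma suffix_last_n: "suffix (last_n l w) w"
  by (simp add: last_n_def suffix_drop)

lemma last_n_suffix: "suffix u w \<Longrightarrow> last_n (length u) w = u"
  by (auto simp: last_n_def suffix_def)

lemma length_last_n: "l \<le> length w \<Longrightarrow> length (last_n l w) = l"
  by (simp add: last_n_def)

lemma card_bool_lists: "card {e :: bool list. length e = j} = 2 ^ j" "finite {e :: bool list. length e = j}"
  using card_lists_length_eq[of "UNIV :: bool set" j] finite_lists_length_eq[of "UNIV :: bool set" j]
  by simp_all

text \<open>Each of these words is recovered from its length and \<open>j\<close> bits.\<close>

lemma card_nonzero_words_le:
  assumes "n \<le> fl j" "j \<ge> 1"
  shows "card (nonzero_words n) \<le> n * 2 ^ j"
proof -
  let ?A = "{1..n} \<times> {e :: bool list. length e = j}"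
  let ?f = "\<lambda>(l, e). last_n l (fibw j @ mw e)"
  have "nonzero_words n \<subseteq> ?f ` ?A"
  proof
    fix w assume "w \<in> nonzero_words n"
    then have w: "w \<noteq> []" "nonzero w" "length w \<le> n" by (auto simp: nonzero_words_def)
    obtain e where e: "length e = j" "suffix w (fibw j @ mw e)"
      using nonzero_suffix_fibw_mw[OF w(2) order_trans[OF w(3) assms(1)] assms(2)] by metis
    have "?f (length w, e) = w" using last_n_suffix[OF e(2)] by simp
    moreover have "length w \<ge> 1" using w(1) by (cases w) auto
    then have "(length w, e) \<in> ?A" using w(3) e(1) by simp
    ultimately show "w \<in> ?f ` ?A" by (metis (no_types, lifting) image_eqI)
  qed
  then have "card (nonzero_words n) \<le> card ?A"
    by (intro surj_card_le) (simp_all add: card_bool_lists)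
  then show ?thesis by (simp add: card_cartesian_product card_bool_lists)
qed

section \<open>Lower bound for the number of nonzero words\<close>

lemma common_suffix_lamw:
  assumes "suffix z (lamw x)" "suffix z (lamw x')"
  obtains y where "suffix y x" "suffix y x'" "z = lamw y \<or> z = Tau # lamw y"
proof -
  have Tau: "Tau # lamw y = lamw (Sigma # y)" for y by simp
  show ?thesis
    using assms(1)
  proof (cases rule: suffix_lamwD)
    case (1 y)
    show ?thesis
      using assms(2)
    proof (cases rule: suffix_lamwD)
      case (1 y')
      then show ?thesis using \<open>z = lamw y\<close> \<open>suffix y x\<close> that lamw_inj by metis
    next
      case (2 y')
      then have "y = Sigma # y'" using \<open>z = lamw y\<close> Tau lamw_inj by metis
      then show ?thesis using \<open>suffix y x\<close> 2 that[of y'] by (metis suffix_ConsD)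
    qed
  next
    case (2 y)
    show ?thesis
      using assms(2)
    proof (cases rule: suffix_lamwD)
      case (1 y')
      then have "y' = Sigma # y" using \<open>z = Tau # lamw y\<close> Tau lamw_inj by metis
      then show ?thesis using 1 2 that[of y] by (metis suffix_ConsD)
    next
      case (2 y')
      then have "y = y'" using \<open>z = Tau # lamw y\<close> lamw_inj by simp
      then show ?thesis
        using \<open>suffix (Tau # y) x\<close> 2 that[of y] by (metis suffix_ConsD)
    qed
  qed
qed

lemma last_suffix: "suffix z w \<Longrightarrow> z \<noteq> [] \<Longrightarrow> last z = last w"
  by (auto simp: suffix_def)

text \<open>The last letter reveals the lowest bit. While bits agree, each level adds at most
  \<open>fl j + fl (Suc j)\<close>, the growth of \<open>fl (j + 3)\<close>; at the first difference
  the common suffix is empty.\<close>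

lemma common_suffix_bound:
  assumes "length e = length e'" "e \<noteq> e'" "length e \<le> k"
    "suffix z (fibw k @ mw e)" "suffix z (fibw k @ mw e')"
  shows "len_lam j z + fl (j + 3) \<le> fl (j + length e + 3)"
  using assms
proof (induction e arbitrary: e' k z j)
  case (Cons b d)
  obtain b' d' where e': "e' = b' # d'" using Cons.prems(1) by (cases e') auto
  obtain k' where k: "k = Suc k'" using Cons.prems(3) by (cases k) auto
  define x where "x = fibw k' @ mw d"
  define x' where "x' = fibw k' @ mw d'"
  have z: "suffix z (lamw x @ (if b then [Sigma] else []))"
    "suffix z (lamw x' @ (if b' then [Sigma] else []))"
    using Cons.prems(4,5) by (simp_all add: x_def x'_def k e' fibw_Suc)
  have "x \<noteq> []" "x' \<noteq> []" by (simp_all add: x_def x'_def)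
  then have last: "last (lamw x) = Tau" "last (lamw x') = Tau" by (simp_all add: last_lamw)
  show ?case
  proof (cases "z = []")
    case True
    have "fl (j + 3) \<le> fl (j + length (b # d) + 3)" by (rule fl_mono) simp
    then show ?thesis using True by simp
  next
    case False
    then have "last z = (if b then Sigma else Tau)" "last z = (if b' then Sigma else Tau)"
      using last last_suffix[OF z(1)] last_suffix[OF z(2)] by (auto split: if_splits)
    then have b: "b = b'" by (auto split: if_splits)
    obtain z' where z': "z = z' @ (if b then [Sigma] else [])" "suffix z' (lamw x)" "suffix z' (lamw x')"
    proof (cases b)
      case True
      then obtain z' where "z = z' @ [Sigma]"
        using z(1) False by (cases z rule: rev_cases) (auto simp: suffix_def)
      then show ?thesis using that[of z'] z b True by simp
    next
      case False
      then show ?thesis using that[of z] z b by simp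
    qed
    obtain y where y: "suffix y x" "suffix y x'" "z' = lamw y \<or> z' = Tau # lamw y"
      using common_suffix_lamw z' by metis
    have "d \<noteq> d'" "length d = length d'" "length d \<le> k'" using Cons.prems e' b k by auto
    then have "len_lam (Suc j) y + fl (Suc j + 3) \<le> fl (Suc j + length d + 3)"
      using Cons.IH[of d' k' y "Suc j"] y x_def x'_def by simp
    moreover have "len_lam j z \<le> fl j + fl (Suc j) + len_lam (Suc j) y"
      using z'(1) y(3) by auto
    moreover have "fl (Suc j + 3) = fl (j + 3) + fl j + fl (Suc j)"
      by (simp add: numeral_3_eq_3 fl_Suc_Suc)
    ultimately show ?thesis by simp
  qed
qed simp

text \<open>Suffixes longer than \<open>fl (j + 3)\<close> determine the bits by
  \<open>common_suffix_bound\<close>, and \<open>fibw (j + 4)\<close> is long enough to supply all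
  lengths up to \<open>fl (j + 4)\<close>. This leaves \<open>fl (j + 2)\<close> lengths.\<close>

lemma card_nonzero_words_ge:
  assumes "fl (j + 4) \<le> n"
  shows "fl (j + 2) * 2 ^ j \<le> card (nonzero_words n)"
proof -
  let ?A = "{fl (j + 3)<..fl (j + 4)} \<times> {e :: bool list. length e = j}"
  let ?f = "\<lambda>(l, e). last_n l (fibw (j + 4) @ mw e)"
  have len: "length (last_n l (fibw (j + 4) @ mw e)) = l" if "l \<le> fl (j + 4)" for l e
    using that by (intro length_last_n) (simp add: length_fibw)
  have "inj_on ?f ?A"
  proof (rule inj_onI)
    fix p p' assume p: "p \<in> ?A" "p' \<in> ?A" "?f p = ?f p'"
    obtain l e l' e' where pe: "p = (l, e)" "p' = (l', e')" by (meson surj_pair)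
    then have l: "l \<in> {fl (j + 3)<..fl (j + 4)}" "l' \<in> {fl (j + 3)<..fl (j + 4)}"
      and e: "j = length e" "length e' = length e"
      and eq: "last_n l (fibw (length e + 4) @ mw e) = last_n l' (fibw (length e + 4) @ mw e')"
      using p by auto
    define z where "z = last_n l (fibw (j + 4) @ mw e)"
    have "length z = l" "length z = l'"
      unfolding z_def using len l eq e by (metis greaterThanAtMost_iff)+
    moreover have "e = e'"
    proof (rule ccontr)
      assume "e \<noteq> e'"
      have "suffix z (fibw (j + 4) @ mw e)" "suffix z (fibw (j + 4) @ mw e')"
        unfolding z_def using eq e suffix_last_n by metis+
      then have "len_lam 0 z + fl (0 + 3) \<le> fl (0 + length e + 3)"
        using \<open>e \<noteq> e'\<close> e by (intro common_suffix_bound[of e e' "j + 4"]) auto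
      then show False using \<open>length z = l\<close> l e by simp
    qed
    ultimately show "p = p'" using pe by simp
  qed
  moreover have "?f ` ?A \<subseteq> nonzero_words n"
  proof
    fix x assume "x \<in> ?f ` ?A"
    then obtain l e where x: "x = last_n l (fibw (length e + 4) @ mw e)"
      and l: "l \<in> {fl (length e + 3)<..fl (length e + 4)}" and e: "j = length e"
      by auto
    let ?z = "last_n l (fibw (length e + 4) @ mw e)"
    \<comment> \<open>Four zero bits followed by a one put the long Fibonacci word in front, so the
      word has the form \<open>mw\<close> and is nonzero.\<close>
    have "mw (e @ replicate 4 False @ [True]) = fibw (length e + 4) @ mw e"
      by (simp add: mw_append mw_replicate_False fibw_def funpow_add del: replicate.simps)
    then have "nonzero (fibw (length e + 4) @ mw e)" using nonzero_mw by metis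
    then have "nonzero ?z" using nonzero_sublist suffix_last_n suffix_imp_sublist by blast
    moreover have "length ?z = l" using len l e by simp
    ultimately show "x \<in> nonzero_words n"
      unfolding nonzero_words_def using x l e assms by auto
  qed
  ultimately have "card ?A \<le> card (nonzero_words n)"
    using finite_nonzero_words by (metis card_inj_on_le)
  moreover have "fl (j + 4) - fl (j + 3) = fl (j + 2)"
    by (simp add: eval_nat_numeral fl_Suc_Suc)
  ultimately show ?thesis by (simp add: card_cartesian_product card_bool_lists)
qed

section \<open>The Gelfand--Kirillov dimension\<close>

definition golden :: real where
  "golden = (1 + sqrt 5) / 2"

lemma golden_gt_1: "golden > 1"
  by (simp add: golden_def)

lemma golden_square: "golden * golden = golden + 1"
  by (simp add: golden_def field_simps)

text \<open>Powers of the golden ratio obey the Fibonacci recurrence, hence the induction over two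
  consecutive indices.\<close>

lemma fl_le_golden: "real (fl j) \<le> golden ^ j"
proof -
  have "real (fl j) \<le> golden ^ j \<and> real (fl (Suc j)) \<le> golden ^ Suc j"
  proof (induction j)
    case (Suc j)
    have "golden ^ Suc (Suc j) = golden ^ j * (golden + 1)"
      by (simp add: golden_square[symmetric])
    then show ?case using Suc by (simp add: fl_Suc_Suc algebra_simps)
  qed (use golden_gt_1 in simp)
  then show ?thesis by simp
qed

lemma golden_le_fl: "golden ^ j \<le> real (fl (Suc j))"
proof -
  have "golden ^ j \<le> real (fl (Suc j)) \<and> golden ^ Suc j \<le> real (fl (Suc (Suc j)))"
  proof (induction j)
    case 0
    have "sqrt 5 \<le> 3" by (rule real_le_lsqrt) auto
    then show ?case by (simp add: fl_Suc_Suc golden_def)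
  next
    case (Suc j)
    have "golden ^ Suc (Suc j) = golden ^ j * (golden + 1)"
      by (simp add: golden_square[symmetric])
    then show ?case using Suc fl_Suc_Suc[of "Suc j"] by (simp add: algebra_simps)
  qed
  then show ?thesis by simp
qed

lemma card_nonzero_words_pos:
  assumes "n \<ge> 1"
  shows "card (nonzero_words n) > 0"
proof -
  have "[Sigma] \<in> nonzero_words n" using assms by (simp add: nonzero_words_def)
  then show ?thesis using finite_nonzero_words card_gt_0_iff by blast
qed

lemma ln_card_le:
  assumes "n \<ge> 2"
  shows "ln (real (card (nonzero_words n))) / ln (real n)
    \<le> 1 + ln 2 / ln golden + (2 * ln 2) / ln (real n)"
proof -
  define x where "x = ln (real n) / ln golden"
  have lng: "ln golden > 0" using golden_gt_1 by simp
  have lnn: "ln (real n) > 0" using assms by simp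
  have x: "x > 0" unfolding x_def using lng lnn by simp
  \<comment> \<open>The least \<open>m\<close> with \<open>n \<le> golden ^ m\<close>. Rounding up
    and the index shift in \<open>golden_le_fl\<close> cost a factor 2 each, whence the error
    \<open>2 * ln 2\<close>.\<close>
  define m where "m = nat \<lceil>x\<rceil>"
  have m: "x \<le> real m" "real m \<le> x + 1"
    unfolding m_def using x by linarith+
  have "ln (real n) \<le> real m * ln golden"
    using m(1) lng by (simp add: x_def field_simps)
  then have "ln (real n) \<le> ln (golden ^ m)"
    using golden_gt_1 by (simp add: ln_realpow)
  then have "real n \<le> golden ^ m"
    using assms golden_gt_1 by simp
  then have "n \<le> fl (Suc m)" using golden_le_fl[of m] by linarith
  then have "card (nonzero_words n) \<le> n * 2 ^ Suc m"
    by (rule card_nonzero_words_le) simp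
  then have "real (card (nonzero_words n)) \<le> real n * 2 ^ Suc m"
    by (metis of_nat_le_iff of_nat_mult of_nat_numeral of_nat_power)
  then have "ln (real (card (nonzero_words n))) \<le> ln (real n * 2 ^ Suc m)"
    using card_nonzero_words_pos[of n] assms by simp
  also have "\<dots> = ln (real n) + real (Suc m) * ln 2"
    using assms ln_mult_pos[of "real n" "2 ^ Suc m"] ln_realpow[of 2 "Suc m"] by simp
  also have "\<dots> \<le> ln (real n) + (x + 2) * ln 2"
    using m(2) by simp
  finally show ?thesis
    using lnn lng by (simp add: x_def field_simps)
qed

lemma ln_card_ge:
  assumes "golden ^ 4 \<le> real n"
  shows "1 + ln 2 / ln golden - (4 * ln golden + 5 * ln 2) / ln (real n)
    \<le> ln (real (card (nonzero_words n))) / ln (real n)"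
proof -
  define x where "x = ln (real n) / ln golden"
  have lng: "ln golden > 0" using golden_gt_1 by simp
  have n1: "real n > 1"
    using assms golden_gt_1 by (meson less_le_trans one_less_power zero_less_numeral)
  then have lnn: "ln (real n) > 0" by simp
  have "ln (golden ^ 4) \<le> ln (real n)"
    using assms golden_gt_1 n1 by simp
  then have x: "x \<ge> 4" unfolding x_def using lng golden_gt_1 by (simp add: ln_realpow field_simps)
  \<comment> \<open>The largest \<open>j\<close> with \<open>golden ^ (j + 4) \<le> n\<close>. The
    estimate \<open>x \<le> j + 5\<close> then produces the constants 4 and 5 of the error
    term.\<close>
  define j where "j = nat \<lfloor>x\<rfloor> - 4"
  have j: "real (j + 4) \<le> x" "x \<le> real j + 5"
    unfolding j_def using x by linarith+
  have "real (j + 4) * ln golden \<le> ln (real n)"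
    using j(1) lng by (simp add: x_def field_simps)
  then have "ln (golden ^ (j + 4)) \<le> ln (real n)"
    using golden_gt_1 by (simp only: ln_realpow)
  then have "golden ^ (j + 4) \<le> real n"
    using golden_gt_1 n1 by (subst (asm) ln_le_cancel_iff) auto
  then have "fl (j + 4) \<le> n" using fl_le_golden[of "j + 4"] by linarith
  then have "fl (j + 2) * 2 ^ j \<le> card (nonzero_words n)" by (rule card_nonzero_words_ge)
  then have "real (fl (j + 2)) * 2 ^ j \<le> real (card (nonzero_words n))"
    by (metis of_nat_le_iff of_nat_mult of_nat_numeral of_nat_power)
  moreover have "golden ^ (j + 1) * 2 ^ j \<le> real (fl (j + 2)) * 2 ^ j"
    using golden_le_fl[of "j + 1"] by (intro mult_right_mono) simp_all
  ultimately have le: "golden ^ (j + 1) * 2 ^ j \<le> real (card (nonzero_words n))" by linarith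
  have "(x - 4) * ln golden + (x - 5) * ln 2 \<le> real (j + 1) * ln golden + real j * ln 2"
    using j(2) lng by (intro add_mono mult_right_mono) auto
  also have "\<dots> = ln (golden ^ (j + 1) * 2 ^ j)"
    using golden_gt_1 ln_mult_pos[of "golden ^ (j + 1)" "2 ^ j"] ln_realpow[of golden "j + 1"]
      ln_realpow[of 2 j] by simp
  also have "\<dots> \<le> ln (real (card (nonzero_words n)))"
    using le golden_gt_1 by (intro ln_mono) auto
  finally have "((x - 4) * ln golden + (x - 5) * ln 2) / ln (real n)
      \<le> ln (real (card (nonzero_words n))) / ln (real n)"
    using lnn by (intro divide_right_mono) auto
  moreover have "1 + ln 2 / ln golden - (4 * ln golden + 5 * ln 2) / ln (real n)
      = ((x - 4) * ln golden + (x - 5) * ln 2) / ln (real n)"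
    using lnn lng by (simp add: x_def field_simps)
  ultimately show ?thesis by simp
qed

text \<open>Both error terms tend to 0, so the quotient converges and the limit superior is its
  limit.\<close>

lemma GK_dim_R2: "GK_dim {s_op, t_op} = ereal (1 + ln 2 / ln golden)"
proof -
  have zero: "(\<lambda>n. c / ln (real n)) \<longlonglongrightarrow> 0" for c :: real
    by (rule tendsto_divide_0[OF tendsto_const filterlim_at_top_imp_at_infinity[
          OF filterlim_compose[OF ln_at_top filterlim_real_sequentially]]])
  have "(\<lambda>n. ln (real (card (nonzero_words n))) / ln (real n)) \<longlonglongrightarrow> 1 + ln 2 / ln golden"
  proof (rule tendsto_sandwich)
    show "\<forall>\<^sub>F n in sequentially. ln (real (card (nonzero_words n))) / ln (real n)
        \<le> 1 + ln 2 / ln golden + (2 * ln 2) / ln (real n)"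
      using eventually_ge_at_top[of 2] by eventually_elim (rule ln_card_le)
    show "\<forall>\<^sub>F n in sequentially. 1 + ln 2 / ln golden - (4 * ln golden + 5 * ln 2) / ln (real n)
        \<le> ln (real (card (nonzero_words n))) / ln (real n)"
      using filterlim_real_sequentially[unfolded filterlim_at_top, rule_format, of "golden ^ 4"]
      by eventually_elim (rule ln_card_ge)
    show "(\<lambda>n. 1 + ln 2 / ln golden - (4 * ln golden + 5 * ln 2) / ln (real n))
        \<longlonglongrightarrow> 1 + ln 2 / ln golden"
      using tendsto_diff[OF tendsto_const zero] by simp
    show "(\<lambda>n. 1 + ln 2 / ln golden + (2 * ln 2) / ln (real n)) \<longlonglongrightarrow> 1 + ln 2 / ln golden"
      using tendsto_add[OF tendsto_const zero] by simp
  qed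
  then have "(\<lambda>n. ereal (ln (real (card (nonzero_words n))) / ln (real n)))
      \<longlonglongrightarrow> ereal (1 + ln 2 / ln golden)"
    by (simp only: lim_ereal)
  then show ?thesis
    unfolding GK_dim_def Z_rank_eq_card by (intro lim_imp_Limsup) simp_all
qed

theorem theorem2:
  shows "((\<forall>w\<in>mu_R2. w ^ 5 = 0) \<and> (\<exists>w\<in>mu_R2. w ^ 4 \<noteq> 0))
    \<and> ((\<forall>i\<ge>1. \<exists>w. w \<noteq> [] \<and> relator i = word w)
       \<and> affords_presentation R2 (case_gen s_op t_op) {relator i | i. i \<ge> 1})
    \<and> GK_dim {s_op, t_op} = ereal (1 + ln 2 / ln ((1 + sqrt 5) / 2))"
  using mu_R2_nil_of_degree_5 relator_is_word R2_presentation GK_dim_R2[unfolded golden_def]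
  by blast

end
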